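(* Let $\varphi:\Gamma\to\mathbb{R}$ be a $G$-positive homomorphism of $\Gamma$. Then the map $\rho$ given on the generators of $\Lambda$ by $$\rho: h_n \longmapsto \frac{\varphi(\tilde G_{(n)})+\varphi(\tilde G_{(n+1)})}{1+\varphi(\tilde G_{(1)})},\qquad n=1,2,\ldots$$ defines a Schur-positive specialization of $\Lambda$.
   Context: $\Lambda=\mathbb{R}[h_1,h_2,\ldots]$ is the ring of symmetric functions over $\mathbb{R}$ in $x_1,x_2,\ldots$, with $h_n$ the complete homogeneous symmetric functions and $s_\lambda$ the Schur functions. A specialization of $\Lambda$ is a (unital $\mathbb{R}$-algebra) homomorphism $\rho:\Lambda\to\mathbb{R}$; it is Schur-positive if $\rho(s_\lambda)\ge 0$ for all partitions $\lambda$. A set-valued tableau of shape $\lambda$ is a filling of the boxes of the Young diagram of $\lambda$ (English notation) by nonempty finite sets of positive integers such that replacing each set by any one of its elements always gives a semistandard Young tableau (weakly increasing along rows, strictly increasing down columns). Define the formal power series $\tilde G_\lambda=\sum_T\prod_{i\ge1}x_i^{\#\,i\text{ in }T}$, the sum being over all set-valued tableaux $T$ of shape $\lambda$ ($\tilde G_\varnothing=1$). The $\tilde G_\lambda$ are linearly independent, and every product $\tilde G_\mu\tilde G_\nu$ is a finite linear combination of the $\tilde G_\lambda$ with nonnegative integer coefficients. Hence $\Gamma:=\bigoplus_\lambda\mathbb{R}\cdot\tilde G_\lambda$ is a commutative unital $\mathbb{R}$-algebra. A homomorphism $\varphi:\Gamma\to\mathbb{R}$ (unital, $\mathbb{R}$-algebra)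 is $G$-positive if $\varphi(\tilde G_\lambda)\ge0$ for all partitions $\lambda$. *)

theory Defs
  imports Complex_Main "HOL-Library.Poly_Mapping"
begin

section \<open>Formal power series in countably many variables\<close>

text \<open>A monomial is a finitely supported exponent vector; the variables are indexed by
  the natural numbers. The variables of interest are those with index at least 1: all symmetric
  functions defined below are supported on monomials that do not involve the variable of index 0.
  The series need not have bounded degree.\<close>

typedef pseries = "UNIV :: ((nat \<Rightarrow>\<^sub>0 nat) \<Rightarrow> real) set"
  morphisms pcoeff Abs_pseries by simp

lemma pcoeff_Abs [simp]: "pcoeff (Abs_pseries f) = f"
  by (simp add: Abs_pseries_inverse)

lemma pseries_eqI: "(\<And>m. pcoeff f m = pcoeff g m) \<Longrightarrow> f = g"
  by (metis pcoeff_inject ext)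

definition splits :: "(nat \<Rightarrow>\<^sub>0 nat) \<Rightarrow> ((nat \<Rightarrow>\<^sub>0 nat) \<times> (nat \<Rightarrow>\<^sub>0 nat)) set" where
  "splits m = {(a, b). a + b = m}"

lemma finite_splits [simp]: "finite (splits m)"
proof -
  define M where "M = (\<Sum>i\<in>Poly_Mapping.keys m. Poly_Mapping.lookup m i)"
  define F where "F = {f. \<forall>i. (i \<in> Poly_Mapping.keys m \<longrightarrow> f i \<in> {..M}) \<and>
    (i \<notin> Poly_Mapping.keys m \<longrightarrow> f i = (0::nat))}"
  define D where "D = {a. Poly_Mapping.lookup a \<in> F}"
  have "finite F"
    unfolding F_def by (rule finite_set_of_finite_funs) auto
  moreover have "inj (Poly_Mapping.lookup :: (nat \<Rightarrow>\<^sub>0 nat) \<Rightarrow> _)"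
    by (simp add: inj_def)
  ultimately have "finite D"
    using finite_vimageI[of F Poly_Mapping.lookup] by (simp add: vimage_def D_def)
  have D: "a \<in> D" if "\<And>i. Poly_Mapping.lookup a i \<le> Poly_Mapping.lookup m i" for a
  proof -
    have "Poly_Mapping.lookup a i \<le> M" if "i \<in> Poly_Mapping.keys m" for i
    proof -
      have "Poly_Mapping.lookup m i \<le> M"
        unfolding M_def by (rule member_le_sum) (use that in auto)
      then show ?thesis
        using \<open>\<And>i. Poly_Mapping.lookup a i \<le> Poly_Mapping.lookup m i\<close>[of i] by linarith
    qed
    moreover have "Poly_Mapping.lookup a i = 0" if "i \<notin> Poly_Mapping.keys m" for i
      using \<open>\<And>i. Poly_Mapping.lookup a i \<le> Poly_Mapping.lookup m i\<close>[of i] that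
      by (simp add: in_keys_iff)
    ultimately show ?thesis
      by (simp add: D_def F_def)
  qed
  have "splits m \<subseteq> D \<times> D"
    unfolding splits_def by (auto intro!: D simp: lookup_add)
  with \<open>finite D\<close> show ?thesis
    by (meson finite_SigmaI rev_finite_subset)
qed

instantiation pseries :: comm_ring_1
begin

definition "0 = Abs_pseries (\<lambda>_. 0)"
definition "1 = Abs_pseries (\<lambda>m. if m = 0 then 1 else 0)"
definition "f + g = Abs_pseries (\<lambda>m. pcoeff f m + pcoeff g m)"
definition "f - g = Abs_pseries (\<lambda>m. pcoeff f m - pcoeff g m)"
definition "- f = Abs_pseries (\<lambda>m. - pcoeff f m)"
definition "f * g = Abs_pseries (\<lambda>m. \<Sum>(a, b)\<in>splits m. pcoeff f a * pcoeff g b)"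

instance
proof
  fix f g h :: pseries
  show "f * g * h = f * (g * h)"
  proof (rule pseries_eqI)
    fix m
    have "pcoeff (f * g * h) m =
        (\<Sum>(x, y)\<in>Sigma (splits m) (\<lambda>(a, b). splits a).
          pcoeff f (fst y) * pcoeff g (snd y) * pcoeff h (snd x))"
      by (subst sum.Sigma[symmetric])
        (auto simp: times_pseries_def sum_distrib_right case_prod_unfold)
    also have "\<dots> =
        (\<Sum>(x, y)\<in>Sigma (splits m) (\<lambda>(a, b). splits b).
          pcoeff f (fst x) * (pcoeff g (fst y) * pcoeff h (snd y)))"
      by (rule sum.reindex_bij_witness
          [where j = "\<lambda>((a, b), (c, d)). ((c, d + b), (d, b))"
             and i = "\<lambda>((a, b), (c, d)). ((a + c, d), (a, c))"])
        (auto simp: splits_def algebra_simps)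
    also have "\<dots> = pcoeff (f * (g * h)) m"
      by (subst sum.Sigma[symmetric])
        (auto simp: times_pseries_def sum_distrib_left case_prod_unfold)
    finally show "pcoeff (f * g * h) m = pcoeff (f * (g * h)) m" .
  qed
  show "f * g = g * f"
  proof (rule pseries_eqI)
    fix m
    show "pcoeff (f * g) m = pcoeff (g * f) m"
      unfolding times_pseries_def pcoeff_Abs
      by (rule sum.reindex_bij_witness[where i = prod.swap and j = prod.swap])
        (auto simp: splits_def algebra_simps)
  qed
  show "1 * f = f"
  proof (rule pseries_eqI)
    fix m
    have "pcoeff (1 * f) m = (\<Sum>p\<in>splits m. if p = (0, m) then pcoeff f m else 0)"
      unfolding times_pseries_def one_pseries_def pcoeff_Abs
      by (rule sum.cong) (auto simp: splits_def split: if_splits)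
    also have "\<dots> = pcoeff f m"
      by (subst sum.delta[OF finite_splits]) (auto simp: splits_def)
    finally show "pcoeff (1 * f) m = pcoeff f m" .
  qed
  show "(f + g) * h = f * h + g * h"
    by (rule pseries_eqI)
      (simp add: times_pseries_def plus_pseries_def case_prod_unfold distrib_right sum.distrib)
  show "(0 :: pseries) \<noteq> 1"
    by (auto simp: zero_pseries_def one_pseries_def Abs_pseries_inject fun_eq_iff)
qed (auto intro!: pseries_eqI simp: plus_pseries_def zero_pseries_def minus_pseries_def
      uminus_pseries_def)

end

instantiation pseries :: real_algebra_1
begin

definition "c *\<^sub>R f = Abs_pseries (\<lambda>m. c * pcoeff f m)"

instance
  by standard
    (auto intro!: pseries_eqI simp: scaleR_pseries_def plus_pseries_def times_pseries_def
      case_prod_unfold sum_distrib_left algebra_simps)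

end


section \<open>Partitions and tableaux\<close>

definition is_partition :: "nat list \<Rightarrow> bool" where
  "is_partition l \<longleftrightarrow> sorted_wrt (\<ge>) l \<and> 0 \<notin> set l"

text \<open>Boxes are pairs (row, column), both counted from 0 (English notation).\<close>

definition diagram :: "nat list \<Rightarrow> (nat \<times> nat) set" where
  "diagram l = {(i, j). i < length l \<and> j < l ! i}"

definition semistandard :: "nat list \<Rightarrow> (nat \<times> nat \<Rightarrow> nat) \<Rightarrow> bool" where
  "semistandard l t \<longleftrightarrow>
     (\<forall>b\<in>diagram l. 1 \<le> t b) \<and>
     (\<forall>i j k. (i, j) \<in> diagram l \<and> (i, k) \<in> diagram l \<and> j < k \<longrightarrow> t (i, j) \<le> t (i, k)) \<and>
     (\<forall>i j k. (i, j) \<in> diagram l \<and> (k, j) \<in> diagram l \<and> i < k \<longrightarrow> t (i, j) < t (k, j))"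

text \<open>A filling is a total function on pairs; outside the diagram it takes a fixed dummy value,
  so that distinct functions represent distinct fillings and the tableaux can be counted.\<close>

definition ssyt :: "nat list \<Rightarrow> (nat \<times> nat \<Rightarrow> nat) set" where
  "ssyt l = {t. semistandard l t \<and> (\<forall>b. b \<notin> diagram l \<longrightarrow> t b = 0)}"

definition set_valued_tableaux :: "nat list \<Rightarrow> (nat \<times> nat \<Rightarrow> nat set) set" where
  "set_valued_tableaux l =
     {T. (\<forall>b\<in>diagram l. finite (T b) \<and> T b \<noteq> {} \<and> T b \<subseteq> {1..}) \<and>
         (\<forall>b. b \<notin> diagram l \<longrightarrow> T b = {}) \<and>
         (\<forall>t. (\<forall>b\<in>diagram l. t b \<in> T b) \<longrightarrow> semistandard l t)}"


section \<open>Symmetric functions\<close>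

text \<open>The sum over all tableaux of the associated monomials is encoded coefficientwise: the
  coefficient of a monomial is the number of tableaux of that weight. These sets of tableaux are
  finite, since all entries lie in the support of the monomial.\<close>

definition schur :: "nat list \<Rightarrow> pseries" where
  "schur l = Abs_pseries (\<lambda>m. real (card
     {t \<in> ssyt l. \<forall>i. card {b \<in> diagram l. t b = i} = Poly_Mapping.lookup m i}))"

definition Gt :: "nat list \<Rightarrow> pseries" where
  "Gt l = Abs_pseries (\<lambda>m. real (card
     {T \<in> set_valued_tableaux l.
       \<forall>i. card {b \<in> diagram l. i \<in> T b} = Poly_Mapping.lookup m i}))"

text \<open>The complete homogeneous symmetric function: the sum of all monomials of degree n in the
  variables of index at least 1.\<close>

definition hsym :: "nat \<Rightarrow> pseries" where
  "hsym n = Abs_pseries (\<lambda>m.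
     if (\<Sum>i\<in>Poly_Mapping.keys m. Poly_Mapping.lookup m i) = n \<and>
       Poly_Mapping.lookup m 0 = 0 then 1 else 0)"

definition is_subalgebra :: "pseries set \<Rightarrow> bool" where
  "is_subalgebra A \<longleftrightarrow> 1 \<in> A \<and>
     (\<forall>f\<in>A. \<forall>g\<in>A. f + g \<in> A \<and> f * g \<in> A) \<and> (\<forall>c. \<forall>f\<in>A. c *\<^sub>R f \<in> A)"

definition Lambda :: "pseries set" where
  "Lambda = is_subalgebra hull {hsym n | n. 1 \<le> n}"

definition Gamma :: "pseries set" where
  "Gamma = span {Gt l | l. is_partition l}"


section \<open>Homomorphisms and positivity\<close>

text \<open>Unital algebra homomorphisms from A to the reals. Such a homomorphism is represented by a
  total function, of which only the values on A are relevant.\<close>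

definition algebra_hom_on :: "pseries set \<Rightarrow> (pseries \<Rightarrow> real) \<Rightarrow> bool" where
  "algebra_hom_on A \<phi> \<longleftrightarrow> \<phi> 1 = 1 \<and>
     (\<forall>f\<in>A. \<forall>g\<in>A. \<phi> (f + g) = \<phi> f + \<phi> g \<and> \<phi> (f * g) = \<phi> f * \<phi> g) \<and>
     (\<forall>c. \<forall>f\<in>A. \<phi> (c *\<^sub>R f) = c * \<phi> f)"

abbreviation specialization :: "(pseries \<Rightarrow> real) \<Rightarrow> bool" where
  "specialization \<rho> \<equiv> algebra_hom_on Lambda \<rho>"

definition schur_positive :: "(pseries \<Rightarrow> real) \<Rightarrow> bool" where
  "schur_positive \<rho> \<longleftrightarrow> (\<forall>l. is_partition l \<longrightarrow> 0 \<le> \<rho> (schur l))"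

definition G_positive :: "(pseries \<Rightarrow> real) \<Rightarrow> bool" where
  "G_positive \<phi> \<longleftrightarrow> (\<forall>l. is_partition l \<longrightarrow> 0 \<le> \<phi> (Gt l))"

end

theory Submission
  imports Defs "Jordan_Normal_Form.Determinant" "HOL-Computational_Algebra.Formal_Power_Series"
begin

text \<open>Put \<open>P = 1 + Gt [1]\<close>, which is the product of all \<open>1 + x\<^sub>i\<close>. The values prescribed for \<open>\<rho>\<close> are
  \<open>\<phi> (P * h\<^sub>n) / \<phi> P\<close>, so \<open>\<rho>\<close> has to be the extension \<open>f \<mapsto> \<phi> (P ^ k * f) / \<phi> P ^ k\<close> of \<open>\<phi>\<close>,
  for large \<open>k\<close>, to those \<open>f\<close> that are carried into \<open>Gamma\<close> by large powers of \<open>P\<close>. Everything thus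
  follows from the fact that \<open>P ^ k * schur l\<close>, for \<open>k \<ge> length l\<close>, is a finite sum of series \<open>Gt \<mu>\<close>.

  In \<open>N\<close> variables, \<open>Gt \<mu>\<close> and \<open>schur \<mu>\<close> are quotients of alternants with the columns
  \<open>x\<^bsup>\<mu> j + N - 1 - j\<^esup> * (1 + x)\<^bsup>j\<^esup>\<close> and \<open>x\<^bsup>\<mu> j + N - 1 - j\<^esup>\<close>, with \<open>j\<close> counted from 0. Multiplying the latter
  by \<open>P ^ k\<close> changes all exponents of \<open>1 + x\<close> to \<open>k\<close>, and column operations turn these into \<open>max k j\<close>.
  Expanding one factor \<open>1 + x\<close> in each of the columns \<open>0, \<dots>, k - 1\<close> decreases \<open>k\<close> by one; it adds
  vertical strips to \<open>\<mu>\<close>, and the strips that do not give a partition lead to equal columns. For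
  \<open>k = 0\<close> only alternants of series \<open>Gt \<mu>\<close> are left, all of them with coefficient 1.\<close>

section \<open>Alternants\<close>

definition alternant :: "(nat \<Rightarrow> 'a::comm_ring_1) \<Rightarrow> nat \<Rightarrow> (nat \<Rightarrow> 'a \<Rightarrow> 'a) \<Rightarrow> 'a" where
  "alternant x n f = det (mat n n (\<lambda>(i, j). f j (x i)))"

text \<open>Letting the permutation act on the row index keeps the column \<open>j\<close> as the
  running index of the product. Column operations then act on single factors, and factors that
  depend only on the row are merely rearranged by \<open>p\<close>.\<close>

lemma alternant_leibniz:
  "alternant x n f = (\<Sum>p | p permutes {0..<n}. signof p * (\<Prod>j<n. f j (x (p j))))"
proof -
  have "alternant x n f = (\<Sum>p | p permutes {0..<n}. signof p *
      (\<Prod>j<n. mat n n (\<lambda>(i, j). f j (x i)) $$ (p j, j)))"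
    unfolding alternant_def by (rule det_col) simp
  also have "\<dots> = (\<Sum>p | p permutes {0..<n}. signof p * (\<Prod>j<n. f j (x (p j))))"
  proof (rule sum.cong[OF refl])
    fix p assume "p \<in> {p. p permutes {0..<n}}"
    then have p: "p permutes {0..<n}" by simp
    have "p j < n" if "j < n" for j
      using permutes_in_image[OF p, of j] that by simp
    then have "(\<Prod>j<n. mat n n (\<lambda>(i, j). f j (x i)) $$ (p j, j)) = (\<Prod>j<n. f j (x (p j)))"
      by (intro prod.cong) auto
    then show "signof p * (\<Prod>j<n. mat n n (\<lambda>(i, j). f j (x i)) $$ (p j, j)) =
        signof p * (\<Prod>j<n. f j (x (p j)))" by simp
  qed
  finally show ?thesis .
qed

lemma alternant_cong:
  assumes "\<And>i j. i < n \<Longrightarrow> j < n \<Longrightarrow> f j (x i) = g j (x i)"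
  shows "alternant x n f = alternant x n g"
  unfolding alternant_def by (rule arg_cong[where f = det]) (auto intro!: eq_matI simp: assms)

lemma alternant_identical_columns:
  assumes "j < n" "k < n" "j \<noteq> k" "\<And>i. i < n \<Longrightarrow> f j (x i) = f k (x i)"
  shows "alternant x n f = 0"
  unfolding alternant_def
  by (rule det_identical_columns[of _ n j k]) (use assms in \<open>auto intro!: eq_vecI simp: col_def\<close>)

lemma alternant_scale_rows:
  "alternant x n (\<lambda>j y. r y * f j y) = (\<Prod>i<n. r (x i)) * alternant x n f"
proof -
  have "(\<Prod>j<n. r (x (p j))) = (\<Prod>i<n. r (x i))" if "p permutes {0..<n}" for p
    using prod.permute[OF that, of "\<lambda>i. r (x i)"] by (simp add: o_def atLeast0LessThan)
  then show ?thesis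
    unfolding alternant_leibniz sum_distrib_left
    by (intro sum.cong) (auto simp: prod.distrib algebra_simps)
qed

lemma alternant_scale_columns:
  "alternant x n (\<lambda>j y. c j * f j y) = (\<Prod>j<n. c j) * alternant x n f"
  unfolding alternant_leibniz sum_distrib_left
  by (intro sum.cong) (auto simp: prod.distrib algebra_simps)

lemma alternant_sum_columns:
  assumes "\<And>j. finite (C j)"
  shows "alternant x n (\<lambda>j y. \<Sum>c\<in>C j. g j c y) =
    (\<Sum>m\<in>Pi\<^sub>E {..<n} C. alternant x n (\<lambda>j. g j (m j)))"
proof -
  have "(\<Prod>j<n. \<Sum>c\<in>C j. g j c (x (p j))) = (\<Sum>m\<in>Pi\<^sub>E {..<n} C. \<Prod>j<n. g j (m j) (x (p j)))" for p
    by (rule prod_sum_PiE) (use assms in auto)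
  then show ?thesis
    unfolding alternant_leibniz by (subst sum.swap) (simp add: sum_distrib_left)
qed

text \<open>By multilinearity each column of \<open>J\<close> contributes either \<open>1\<close> or
  \<open>y\<close>. Multiplying column \<open>j\<close> by \<open>y\<close> will later mean adding a
  box to row \<open>j\<close> of a shape.\<close>

lemma alternant_add_variable:
  assumes "J \<subseteq> {..<n}"
  shows "alternant x n (\<lambda>j y. (if j \<in> J then 1 + y else 1) * f j y) =
    (\<Sum>S\<in>Pow J. alternant x n (\<lambda>j y. (if j \<in> S then y else 1) * f j y))"
proof -
  have fin: "finite J" using assms finite_subset by blast
  have expand: "(\<Prod>j<n. (if j \<in> J then 1 + z j else 1) * h j) =
      (\<Sum>S\<in>Pow J. \<Prod>j<n. (if j \<in> S then z j else 1) * h j)" for z h :: "nat \<Rightarrow> 'a"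
  proof -
    have J: "{..<n} \<inter> S = S" if "S \<subseteq> J" for S using assms that by auto
    have restr: "(\<Prod>j<n. if j \<in> S then z' j else 1) = (\<Prod>j\<in>S. z' j)" if "S \<subseteq> J" for S z'
      using J[OF that] by (simp add: prod.inter_restrict[symmetric])
    have "(\<Prod>j\<in>J. 1 + z j) = (\<Sum>S\<in>Pow J. \<Prod>j\<in>S. z j)"
      using prod_add[OF fin, of z "\<lambda>_. 1"] by (simp add: add.commute)
    then show ?thesis
      unfolding prod.distrib sum_distrib_right[symmetric]
      by (simp add: restr)
  qed
  show ?thesis
    unfolding alternant_leibniz by (subst sum.swap) (simp only: expand sum_distrib_left)
qed

text \<open>An elementary symmetric polynomial is invariant under permuting the variables, so in the
  Leibniz term of \<open>p\<close> it may be evaluated at the \<open>x (p j)\<close>. Its monomial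
  for \<open>S\<close> then multiplies exactly the factors of the columns in \<open>S\<close>. This
  is the source of the Pieri rule.\<close>

lemma alternant_esym:
  "(\<Sum>S | S \<subseteq> {..<n} \<and> card S = k. \<Prod>i\<in>S. x i) * alternant x n f =
   (\<Sum>S | S \<subseteq> {..<n} \<and> card S = k. alternant x n (\<lambda>j y. (if j \<in> S then y else 1) * f j y))"
proof -
  let ?A = "{S. S \<subseteq> {..<n} \<and> card S = k}"
  have *: "(\<Sum>S\<in>?A. \<Prod>i\<in>S. x i) * (\<Prod>j<n. f j (x (p j))) =
      (\<Sum>S\<in>?A. \<Prod>j<n. (if j \<in> S then x (p j) else 1) * f j (x (p j)))"
    if p: "p permutes {..<n}" for p
  proof -
    have inj: "inj p" using p by (rule permutes_inj)
    have "(\<Sum>S\<in>?A. \<Prod>i\<in>S. x i) = (\<Sum>S\<in>?A. \<Prod>i\<in>p ` S. x i)"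
    proof (rule sum.reindex_bij_witness[where i = "\<lambda>S. p ` S" and j = "\<lambda>S. inv_into UNIV p ` S"])
      fix S assume S: "S \<in> ?A"
      have ip: "inv_into UNIV p permutes {..<n}" by (rule permutes_inv[OF p])
      show "p ` inv_into UNIV p ` S = S"
        using permutes_surj[OF p] by (simp add: image_f_inv_f)
      show "inv_into UNIV p ` p ` S = S" using inj by simp
      show "inv_into UNIV p ` S \<in> ?A"
        using S image_mono[of S "{..<n}" "inv_into UNIV p"] permutes_image[OF ip] 
          card_image[OF inj_on_subset[OF permutes_inj[OF ip] subset_UNIV], of S] by simp
      show "p ` S \<in> ?A"
        using S image_mono[of S "{..<n}" p] permutes_image[OF p]
          card_image[OF inj_on_subset[OF inj subset_UNIV], of S] by simp
      show "(\<Prod>i\<in>p ` inv_into UNIV p ` S. x i) = (\<Prod>i\<in>S. x i)"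
        using permutes_surj[OF p] by (simp add: image_f_inv_f)
    qed
    also have "\<dots> = (\<Sum>S\<in>?A. \<Prod>j<n. if j \<in> S then x (p j) else 1)"
    proof (rule sum.cong[OF refl])
      fix S assume "S \<in> ?A"
      then have "{..<n} \<inter> S = S" by auto
      then have "(\<Prod>j<n. if j \<in> S then x (p j) else 1) = (\<Prod>j\<in>S. x (p j))"
        by (simp add: prod.inter_restrict[symmetric])
      then show "(\<Prod>i\<in>p ` S. x i) = (\<Prod>j<n. if j \<in> S then x (p j) else 1)"
        using inj by (simp add: prod.reindex inj_on_subset)
    qed
    finally show ?thesis by (simp add: sum_distrib_right prod.distrib)
  qed
  have "(\<Sum>S\<in>?A. \<Prod>i\<in>S. x i) * alternant x n f =
      (\<Sum>p | p permutes {0..<n}. signof p * ((\<Sum>S\<in>?A. \<Prod>i\<in>S. x i) * (\<Prod>j<n. f j (x (p j)))))"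
    unfolding alternant_leibniz sum_distrib_left by (simp only: mult.left_commute)
  also have "\<dots> = (\<Sum>p | p permutes {0..<n}. signof p *
      (\<Sum>S\<in>?A. \<Prod>j<n. (if j \<in> S then x (p j) else 1) * f j (x (p j))))"
    by (intro sum.cong refl arg_cong2[where f = "(*)"] *) (simp add: atLeast0LessThan)
  also have "\<dots> = (\<Sum>S\<in>?A. alternant x n (\<lambda>j y. (if j \<in> S then y else 1) * f j y))"
    unfolding alternant_leibniz sum_distrib_left by (rule sum.swap)
  finally show ?thesis .
qed

text \<open>The new matrix is the old one times the triangular matrix \<open>u\<close>. Lower
  triangular \<open>u\<close> combine a column with later ones, upper triangular \<open>u\<close>
  with earlier ones; both occur below.\<close>

lemma alternant_column_operation:
  assumes tri: "(\<forall>c<n. \<forall>j<c. u c j = 0) \<or> (\<forall>j<n. \<forall>c<j. u c j = 0)"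
    and g: "\<And>i j. i < n \<Longrightarrow> j < n \<Longrightarrow> g j (x i) = (\<Sum>c<n. f c (x i) * u c j)"
  shows "alternant x n g = (\<Prod>j<n. u j j) * alternant x n f"
proof -
  let ?A = "mat n n (\<lambda>(i, j). f j (x i))" and ?U = "mat n n (\<lambda>(c, j). u c j)"
  have "mat n n (\<lambda>(i, j). g j (x i)) = ?A * ?U"
    by (rule eq_matI) (auto simp: g scalar_prod_def atLeast0LessThan)
  moreover have "det ?U = (\<Prod>j<n. u j j)"
  proof -
    have diag: "diag_mat ?U = map (\<lambda>j. u j j) [0..<n]"
      by (auto simp: diag_mat_def)
    have "det ?U = prod_list (diag_mat ?U)"
      using tri
    proof
      assume "\<forall>c<n. \<forall>j<c. u c j = 0"
      then show ?thesis
        by (intro det_upper_triangular[of _ n]) (auto simp: upper_triangular_def)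
    next
      assume "\<forall>j<n. \<forall>c<j. u c j = 0"
      then show ?thesis
        by (intro det_lower_triangular[of n]) auto
    qed
    then show ?thesis
      by (simp add: diag prod.distinct_set_conv_list[symmetric] atLeast0LessThan)
  qed
  ultimately show ?thesis
    by (simp add: alternant_def det_mult[of _ n])
qed

lemma alternant_0 [simp]: "alternant x 0 f = 1"
  by (simp add: alternant_def)

lemma alternant_last_row:
  assumes "\<And>j. j < n \<Longrightarrow> f j (x n) = 0"
  shows "alternant x (Suc n) f = f n (x n) * alternant x n f"
proof -
  let ?A = "mat (Suc n) (Suc n) (\<lambda>(i, j). f j (x i))"
  have "mat_delete ?A n n = mat n n (\<lambda>(i, j). f j (x i))"
    by (rule eq_matI) (auto simp: mat_delete_def)
  then have "cofactor ?A n n = alternant x n f"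
    by (simp add: cofactor_def alternant_def mult_2[symmetric] del: mult_2)
  moreover have "alternant x (Suc n) f = (\<Sum>j<Suc n. ?A $$ (n, j) * cofactor ?A n j)"
    unfolding alternant_def by (rule laplace_expansion_row) auto
  ultimately show ?thesis
    by (simp add: assms)
qed

section \<open>Power series and their truncations\<close>

lemma pcoeff_zero [simp]: "pcoeff 0 m = 0"
  and pcoeff_one: "pcoeff 1 m = (if m = 0 then 1 else 0)"
  and pcoeff_add [simp]: "pcoeff (f + g) m = pcoeff f m + pcoeff g m"
  and pcoeff_uminus [simp]: "pcoeff (- f) m = - pcoeff f m"
  and pcoeff_mult: "pcoeff (f * g) m = (\<Sum>(a, b)\<in>splits m. pcoeff f a * pcoeff g b)"
  by (simp_all add: zero_pseries_def one_pseries_def plus_pseries_def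
      uminus_pseries_def times_pseries_def)

lemma pcoeff_sum [simp]: "pcoeff (\<Sum>i\<in>A. f i) m = (\<Sum>i\<in>A. pcoeff (f i) m)"
  by (induction A rule: infinite_finite_induct) auto

section \<open>Monomials and cancellation of linear factors\<close>

definition Mon :: "(nat \<Rightarrow>\<^sub>0 nat) \<Rightarrow> pseries" where
  "Mon a = Abs_pseries (\<lambda>m. if m = a then 1 else 0)"

lemma pcoeff_Mon: "pcoeff (Mon a) m = (if m = a then 1 else 0)"
  by (simp add: Mon_def)

lemma pcoeff_Mon_mult: "pcoeff (Mon a * f) (a + b) = pcoeff f b"
proof -
  have "pcoeff (Mon a * f) (a + b) = (\<Sum>p\<in>splits (a + b). if p = (a, b) then pcoeff f b else 0)"
    unfolding pcoeff_mult by (rule sum.cong) (auto simp: splits_def pcoeff_Mon split: if_splits)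
  also have "\<dots> = pcoeff f b"
    by (subst sum.delta[OF finite_splits]) (auto simp: splits_def)
  finally show ?thesis .
qed

lemma pcoeff_Mon_mult_eq_0:
  assumes "\<And>b. m \<noteq> a + b"
  shows "pcoeff (Mon a * f) m = 0"
  unfolding pcoeff_mult by (rule sum.neutral) (use assms in \<open>auto simp: splits_def pcoeff_Mon\<close>)

lemma Mon_zero: "Mon 0 = 1"
  by (rule pseries_eqI) (simp add: pcoeff_Mon pcoeff_one)

lemma Mon_mult: "Mon a * Mon b = Mon (a + b)"
proof (rule pseries_eqI)
  fix m
  show "pcoeff (Mon a * Mon b) m = pcoeff (Mon (a + b)) m"
  proof (cases "\<exists>c. m = a + c")
    case True
    then show ?thesis by (auto simp: pcoeff_Mon_mult pcoeff_Mon)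
  next
    case False
    then show ?thesis by (auto simp: pcoeff_Mon_mult_eq_0 pcoeff_Mon)
  qed
qed

lemma prod_Mon: "(\<Prod>i\<in>A. Mon (a i)) = Mon (\<Sum>i\<in>A. a i)"
  by (induction A rule: infinite_finite_induct) (auto simp: Mon_zero Mon_mult)

definition X :: "nat \<Rightarrow> pseries" where
  "X i = Mon (Poly_Mapping.single i 1)"

lemma pcoeff_X_mult: "pcoeff (X i * f) (m + Poly_Mapping.single i 1) = pcoeff f m"
  unfolding X_def using pcoeff_Mon_mult[of "Poly_Mapping.single i 1" f m] by (simp add: add.commute)

lemma pcoeff_X_mult_eq_0:
  assumes "Poly_Mapping.lookup m i = 0"
  shows "pcoeff (X i * f) m = 0"
  unfolding X_def by (rule pcoeff_Mon_mult_eq_0) (use assms in \<open>auto simp: lookup_add\<close>)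

lemma lookup_pos_decompose:
  assumes "Poly_Mapping.lookup m i \<noteq> (0::nat)"
  obtains m' where "m = m' + Poly_Mapping.single i 1"
proof
  show "m = (m - Poly_Mapping.single i 1) + Poly_Mapping.single i 1"
    using assms by (intro poly_mapping_eqI) (auto simp: lookup_add lookup_minus lookup_single when_def)
qed

text \<open>For \<open>h = f - g\<close> the relation \<open>X i * h = X j * h\<close> equates the
  coefficient of \<open>h\<close> at a monomial with the one obtained by trading a factor
  \<open>X j\<close> for \<open>X i\<close>. This lowers the exponent of \<open>X j\<close> until it
  is zero, where \<open>X j * h\<close> has no coefficient.\<close>

lemma X_diff_cancel:
  assumes "i \<noteq> j" "(X i - X j) * f = (X i - X j) * g"
  shows "f = g"
proof -
  define h where "h = f - g"
  have eq: "X i * h = X j * h"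
    using assms(2) by (simp add: h_def algebra_simps)
  have "pcoeff h m = 0" for m
  proof (induction "Poly_Mapping.lookup m j" arbitrary: m)
    case 0
    have "pcoeff h m = pcoeff (X j * h) (m + Poly_Mapping.single i 1)"
      by (simp only: eq[symmetric] pcoeff_X_mult)
    also have "\<dots> = 0"
      using 0 assms(1) by (intro pcoeff_X_mult_eq_0) (simp add: lookup_add lookup_single)
    finally show ?case .
  next
    case (Suc n)
    obtain m' where m': "m = m' + Poly_Mapping.single j 1"
      using lookup_pos_decompose[of m j] Suc(2) by (metis Zero_not_Suc)
    have "pcoeff h m = pcoeff (X j * h) (m' + Poly_Mapping.single i 1 + Poly_Mapping.single j 1)"
      by (simp only: eq[symmetric] m' pcoeff_X_mult add.assoc add.commute[of "Poly_Mapping.single i 1"])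
        (simp only: add.assoc[symmetric] pcoeff_X_mult)
    also have "\<dots> = pcoeff h (m' + Poly_Mapping.single i 1)"
      by (rule pcoeff_X_mult)
    also have "\<dots> = 0"
      using Suc(2) assms(1) m' by (intro Suc(1)) (auto simp: lookup_add lookup_single)
    finally show ?case .
  qed
  then have "h = 0" by (intro pseries_eqI) simp
  then show ?thesis by (simp add: h_def)
qed

text \<open>Here \<open>h = - (X j * h)\<close>, so each coefficient of \<open>h\<close> is minus
  the one with the exponent of \<open>X j\<close> lowered by one, and is zero if that exponent is
  zero.\<close>

lemma one_plus_X_cancel:
  assumes "(1 + X j) * f = (1 + X j) * g"
  shows "f = g"
proof -
  define h where "h = f - g"
  have eq: "h = - (X j * h)"
    using assms by (simp add: h_def algebra_simps)
  have "pcoeff h m = 0" for m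
  proof (induction "Poly_Mapping.lookup m j" arbitrary: m)
    case 0
    then show ?case by (subst eq) (simp add: pcoeff_X_mult_eq_0)
  next
    case (Suc n)
    obtain m' where m': "m = m' + Poly_Mapping.single j 1"
      using lookup_pos_decompose[of m j] Suc(2) by (metis Zero_not_Suc)
    have "pcoeff h m' = 0" using Suc(2) m' by (intro Suc(1)) (simp add: lookup_add)
    then show ?case by (subst eq) (simp add: pcoeff_X_mult m' del: One_nat_def)
  qed
  then have "h = 0" by (intro pseries_eqI) simp
  then show ?thesis by (simp add: h_def)
qed

text \<open>This sets all variables of index above \<open>N\<close> to zero. The series of interest
  do not involve the variable of index 0, so \<open>N\<close> variables remain.\<close>

definition trunc :: "nat \<Rightarrow> pseries \<Rightarrow> pseries" where
  "trunc N f = Abs_pseries (\<lambda>m. if Poly_Mapping.keys m \<subseteq> {..N} then pcoeff f m else 0)"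

lemma pcoeff_trunc: "pcoeff (trunc N f) m = (if Poly_Mapping.keys m \<subseteq> {..N} then pcoeff f m else 0)"
  by (simp add: trunc_def)

lemma keys_add_nat: "Poly_Mapping.keys (a + b) = Poly_Mapping.keys a \<union> Poly_Mapping.keys (b :: 'a \<Rightarrow>\<^sub>0 nat)"
  by (auto simp: in_keys_iff lookup_add)

lemma trunc_add [simp]: "trunc N (f + g) = trunc N f + trunc N g"
  by (rule pseries_eqI) (simp add: pcoeff_trunc)

lemma trunc_zero [simp]: "trunc N 0 = 0"
  by (rule pseries_eqI) (simp add: pcoeff_trunc)

lemma trunc_uminus [simp]: "trunc N (- f) = - trunc N f"
  by (rule pseries_eqI) (simp add: pcoeff_trunc)

lemma trunc_one [simp]: "trunc N 1 = 1"
  by (rule pseries_eqI) (simp add: pcoeff_trunc pcoeff_one)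

lemma trunc_sum [simp]: "trunc N (\<Sum>i\<in>A. f i) = (\<Sum>i\<in>A. trunc N (f i))"
  by (induction A rule: infinite_finite_induct) auto

text \<open>Exponents are natural numbers, so a product of monomials avoids the large variables
  exactly if both factors do.\<close>

lemma trunc_mult [simp]: "trunc N (f * g) = trunc N f * trunc N g"
proof (rule pseries_eqI)
  fix m
  show "pcoeff (trunc N (f * g)) m = pcoeff (trunc N f * trunc N g) m"
  proof (cases "Poly_Mapping.keys m \<subseteq> {..N}")
    case True
    then show ?thesis
      by (auto simp: pcoeff_trunc pcoeff_mult splits_def keys_add_nat intro!: sum.cong)
  next
    case False
    then have "pcoeff (trunc N f * trunc N g) m = 0"
      unfolding pcoeff_mult by (intro sum.neutral) (auto simp: pcoeff_trunc splits_def keys_add_nat)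
    with False show ?thesis by (simp add: pcoeff_trunc)
  qed
qed

lemma trunc_power [simp]: "trunc N (f ^ k) = trunc N f ^ k"
  by (induction k) auto

text \<open>A monomial involves finitely many variables, so every coefficient is visible in all
  large truncations. This reduces identities of series to determinants in \<open>N\<close>
  variables.\<close>

lemma trunc_eqI:
  assumes "\<And>N. N \<ge> N0 \<Longrightarrow> trunc N f = trunc N g"
  shows "f = g"
proof (rule pseries_eqI)
  fix m :: "nat \<Rightarrow>\<^sub>0 nat"
  obtain N where "Poly_Mapping.keys m \<subseteq> {..N}"
    using finite_keys[of m] unfolding finite_nat_set_iff_bounded_le by (auto simp: subset_iff)
  then have "Poly_Mapping.keys m \<subseteq> {..max N N0}" by auto
  then show "pcoeff f m = pcoeff g m"
    using arg_cong[OF assms[of "max N N0"], of "\<lambda>f. pcoeff f m"] by (simp add: pcoeff_trunc)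
qed

section \<open>Branching of set-valued tableaux\<close>

definition boxes :: "(nat \<Rightarrow> nat) \<Rightarrow> (nat \<times> nat) set" where
  "boxes \<mu> = {(i, j). j < \<mu> i}"

text \<open>In contrast to \<open>set_valued_tableaux\<close>, the condition on all selections is
  replaced by comparisons of pairs of entries, and the entries are bounded. Shapes are functions, so
  that rows may become empty under branching without a change of type or length.\<close>

definition svt :: "nat \<Rightarrow> (nat \<Rightarrow> nat) \<Rightarrow> (nat \<times> nat \<Rightarrow> nat set) set" where
  "svt N \<mu> = {T.
     (\<forall>i j. j < \<mu> i \<longrightarrow> T (i, j) \<noteq> {} \<and> T (i, j) \<subseteq> {1..N}) \<and>
     (\<forall>i j. \<not> j < \<mu> i \<longrightarrow> T (i, j) = {}) \<and>
     (\<forall>i j k s t. j < k \<and> s \<in> T (i, j) \<and> t \<in> T (i, k) \<longrightarrow> s \<le> t) \<and>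
     (\<forall>i j k s t. i < k \<and> s \<in> T (i, j) \<and> t \<in> T (k, j) \<longrightarrow> s < t)}"

lemma svtI:
  assumes "\<And>i j. T (i, j) \<noteq> {} \<longleftrightarrow> j < \<mu> i" "\<And>i j. T (i, j) \<subseteq> {1..N}"
    "\<And>i j k s t. j < k \<Longrightarrow> s \<in> T (i, j) \<Longrightarrow> t \<in> T (i, k) \<Longrightarrow> s \<le> t"
    "\<And>i j k s t. i < k \<Longrightarrow> s \<in> T (i, j) \<Longrightarrow> t \<in> T (k, j) \<Longrightarrow> s < t"
  shows "T \<in> svt N \<mu>"
  unfolding svt_def mem_Collect_eq
proof (intro conjI allI impI)
  show "T (i, j) = {}" if "\<not> j < \<mu> i" for i j using that assms(1)[of i j] by simp
  show "s \<le> t" if "j < k \<and> s \<in> T (i, j) \<and> t \<in> T (i, k)" for i j k s t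
    using assms(3)[of j k s i t] that by simp
  show "s < t" if "i < k \<and> s \<in> T (i, j) \<and> t \<in> T (k, j)" for i j k s t
    using assms(4)[of i k s j t] that by simp
qed (use assms(1,2) in auto)

context
  fixes T N \<mu>
  assumes T: "T \<in> svt N \<mu>"
begin

lemma svt_nonempty_iff: "T (i, j) \<noteq> {} \<longleftrightarrow> j < \<mu> i"
  using T[unfolded svt_def mem_Collect_eq, THEN conjunct1, rule_format, of j i]
    T[unfolded svt_def mem_Collect_eq, THEN conjunct2, THEN conjunct1, rule_format, of j i] by metis

lemma svt_subset: "T (i, j) \<subseteq> {1..N}"
  using T[unfolded svt_def mem_Collect_eq, THEN conjunct1, rule_format, of j i]
    T[unfolded svt_def mem_Collect_eq, THEN conjunct2, THEN conjunct1, rule_format, of j i]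
  by (metis empty_subsetI)

lemma svt_row: "j < k \<Longrightarrow> s \<in> T (i, j) \<Longrightarrow> t \<in> T (i, k) \<Longrightarrow> s \<le> t"
  by (rule T[unfolded svt_def mem_Collect_eq, THEN conjunct2, THEN conjunct2, THEN conjunct1, rule_format])
    (intro conjI)

lemma svt_column: "i < k \<Longrightarrow> s \<in> T (i, j) \<Longrightarrow> t \<in> T (k, j) \<Longrightarrow> s < t"
  by (rule T[unfolded svt_def mem_Collect_eq, THEN conjunct2, THEN conjunct2, THEN conjunct2, rule_format])
    (intro conjI)

end

text \<open>The parameter \<open>\<beta>\<close> treats both families at once: \<open>\<beta> = 1\<close> gives the series \<open>Gt\<close>, and \<open>\<beta> = 0\<close>
  gives the Schur functions, because \<open>0 ^ (card A - 1)\<close> keeps exactly the boxes with one entry.\<close>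

definition box_weight :: "pseries \<Rightarrow> nat set \<Rightarrow> pseries" where
  "box_weight \<beta> A = \<beta> ^ (card A - 1) * (\<Prod>i\<in>A. X i)"

definition tableau_sum :: "pseries \<Rightarrow> nat \<Rightarrow> (nat \<Rightarrow> nat) \<Rightarrow> pseries" where
  "tableau_sum \<beta> N \<mu> = (\<Sum>T\<in>svt N \<mu>. \<Prod>b\<in>boxes \<mu>. box_weight \<beta> (T b))"

text \<open>For a weakly decreasing \<mu> with at most \<open>Suc N\<close> rows, these are the
  shapes with at most \<open>N\<close> rows whose complement in \<mu> is a horizontal strip, the
  place for boxes that contain only \<open>Suc N\<close>.\<close>

definition interlacing :: "nat \<Rightarrow> (nat \<Rightarrow> nat) \<Rightarrow> (nat \<Rightarrow> nat) set" where
  "interlacing N \<mu> = {\<nu>. (\<forall>i<N. \<mu> (Suc i) \<le> \<nu> i \<and> \<nu> i \<le> \<mu> i) \<and> (\<forall>i\<ge>N. \<nu> i = 0)}"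

text \<open>The last box of such a row of \<nu> has no box of \<mu> below it, so
  \<open>Suc N\<close> may join its entries.\<close>

definition free_rows :: "nat \<Rightarrow> (nat \<Rightarrow> nat) \<Rightarrow> (nat \<Rightarrow> nat) \<Rightarrow> nat set" where
  "free_rows N \<mu> \<nu> = {i. i < N \<and> \<mu> (Suc i) < \<nu> i}"

lemma finite_boxes:
  assumes "\<And>i. i \<ge> n \<Longrightarrow> \<mu> i = 0"
  shows "finite (boxes \<mu>)"
proof -
  have "boxes \<mu> = Sigma {..<n} (\<lambda>i. {..<\<mu> i})"
    using assms by (force simp: boxes_def not_less[symmetric])
  then show ?thesis by simp
qed

lemma finite_svt:
  assumes "finite (boxes \<mu>)"
  shows "finite (svt N \<mu>)"
proof -
  let ?F = "{T. \<forall>b. (b \<in> boxes \<mu> \<longrightarrow> T b \<in> Pow {1..N}) \<and> (b \<notin> boxes \<mu> \<longrightarrow> T b = {})}"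
  have "finite ?F" using assms by (rule finite_set_of_finite_funs) simp
  moreover have "svt N \<mu> \<subseteq> ?F"
    using svt_subset svt_nonempty_iff by (fastforce simp: boxes_def)
  ultimately show ?thesis by (rule rev_finite_subset)
qed

lemma finite_interlacing: "finite (interlacing N \<mu>)"
proof (rule finite_subset)
  show "interlacing N \<mu> \<subseteq> {\<nu>. \<forall>i. (i \<in> {..<N} \<longrightarrow> \<nu> i \<in> {..(\<Sum>i<N. \<mu> i)}) \<and> (i \<notin> {..<N} \<longrightarrow> \<nu> i = 0)}"
    using member_le_sum[of _ "{..<N}" \<mu>] by (auto simp: interlacing_def intro: order_trans)
  show "finite {\<nu>. \<forall>i. (i \<in> {..<N} \<longrightarrow> \<nu> i \<in> {..(\<Sum>i<N. \<mu> i)}) \<and> (i \<notin> {..<N} \<longrightarrow> \<nu> i = (0::nat))}"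
    by (rule finite_set_of_finite_funs) auto
qed

lemma downset_eq_lessThan:
  assumes "finite A" "\<And>j k. k \<in> A \<Longrightarrow> j < k \<Longrightarrow> j \<in> A"
  shows "A = {..<card A}"
proof -
  have "\<exists>n. A = {..<n}"
  proof (cases "A = {}")
    case False
    have "A = {..<Suc (Max A)}"
      using assms Max_in[OF assms(1) False] Max_ge[OF assms(1)] by (auto simp: less_Suc_eq_le) (metis le_neq_implies_less)
    then show ?thesis by blast
  qed auto
  then show ?thesis by auto
qed

text \<open>Columns increase strictly, starting from an entry that is at least 1. Hence entries up
  to \<open>N\<close> occur only in the rows \<open>0, ..., N - 1\<close>.\<close>

lemma svt_entry_gt_row:
  assumes T: "T \<in> svt N \<mu>" and "antimono \<mu>" and "s \<in> T (i, j)"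
  shows "i < s"
  using assms(3)
proof (induction i arbitrary: s)
  case 0
  then show ?case using svt_subset[OF T, of 0 j] by auto
next
  case (Suc i)
  have "j < \<mu> (Suc i)" using Suc.prems svt_nonempty_iff[OF T, of "Suc i" j] by blast
  also have "\<mu> (Suc i) \<le> \<mu> i" using assms(2) by (simp add: antimonoD)
  finally obtain t where t: "t \<in> T (i, j)" using svt_nonempty_iff[OF T, of i j] by blast
  then have "t < s" using svt_column[OF T] Suc.prems by blast
  with Suc.IH[OF t] show ?case by simp
qed

text \<open>Branching removes the largest entry \<open>Suc N\<close>. The boxes with a smaller entry form the shape
  \<open>inner_shape\<close>; a box of it that also contains \<open>Suc N\<close> is the last one of its row, and the row is
  then in \<open>shared_rows\<close>. The map \<open>glue\<close> is the inverse.\<close>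

definition inner_shape :: "nat \<Rightarrow> (nat \<times> nat \<Rightarrow> nat set) \<Rightarrow> nat \<Rightarrow> nat" where
  "inner_shape N T i = card {j. T (i, j) \<inter> {..N} \<noteq> {}}"

definition shared_rows :: "nat \<Rightarrow> (nat \<times> nat \<Rightarrow> nat set) \<Rightarrow> nat set" where
  "shared_rows N T = {i. \<exists>j. T (i, j) \<inter> {..N} \<noteq> {} \<and> Suc N \<in> T (i, j)}"

definition glue :: "nat \<Rightarrow> (nat \<Rightarrow> nat) \<Rightarrow> (nat \<Rightarrow> nat) \<Rightarrow> (nat \<times> nat \<Rightarrow> nat set) \<Rightarrow> nat set \<Rightarrow>
    nat \<times> nat \<Rightarrow> nat set" where
  "glue N \<mu> \<nu> T U = (\<lambda>(i, j).
     if j < \<nu> i then T (i, j) \<union> (if i \<in> U \<and> Suc j = \<nu> i then {Suc N} else {})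
     else if j < \<mu> i then {Suc N} else {})"

context
  fixes N :: nat and \<mu> :: "nat \<Rightarrow> nat"
  assumes anti: "antimono \<mu>" and len: "\<And>i. i > N \<Longrightarrow> \<mu> i = 0"
begin

text \<open>A box to the left of one with an entry at most \<open>N\<close> has only such entries.
  So these boxes form an initial segment of the row, which is determined by its cardinality.\<close>

lemma less_inner_shape_iff:
  assumes T: "T \<in> svt (Suc N) \<mu>"
  shows "j < inner_shape N T i \<longleftrightarrow> T (i, j) \<inter> {..N} \<noteq> {}"
proof -
  let ?A = "{j. T (i, j) \<inter> {..N} \<noteq> {}}"
  have sub: "?A \<subseteq> {..<\<mu> i}" using svt_nonempty_iff[OF T] by blast
  have "?A = {..<card ?A}"
  proof (rule downset_eq_lessThan)
    show "finite ?A" using sub finite_subset by blast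
  next
    fix j k assume k: "k \<in> ?A" and jk: "j < k"
    then obtain t where t: "t \<in> T (i, k)" "t \<le> N" by auto
    have "j < \<mu> i" using sub k jk by auto
    then obtain s where s: "s \<in> T (i, j)" using svt_nonempty_iff[OF T, of i j] by blast
    have "s \<le> t" using svt_row[OF T jk] s t by blast
    then show "j \<in> ?A" using s t by auto
  qed
  then show ?thesis unfolding inner_shape_def by blast
qed

lemma Suc_in_svt_iff:
  assumes T: "T \<in> svt (Suc N) \<mu>" and j: "j < inner_shape N T i"
  shows "Suc N \<in> T (i, j) \<longleftrightarrow> i \<in> shared_rows N T \<and> Suc j = inner_shape N T i"
proof -
  have *: "Suc j = inner_shape N T i" if j: "j < inner_shape N T i" and "Suc N \<in> T (i, j)" for j
  proof (rule ccontr)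
    assume "Suc j \<noteq> inner_shape N T i"
    then have "Suc j < inner_shape N T i" using j by simp
    then obtain t where "t \<in> T (i, Suc j)" "t \<le> N" using less_inner_shape_iff[OF T] by blast
    moreover have "Suc N \<le> t"
      using svt_row[OF T, of j "Suc j"] \<open>Suc N \<in> T (i, j)\<close> \<open>t \<in> T (i, Suc j)\<close> by blast
    ultimately show False by simp
  qed
  show ?thesis
  proof
    assume "Suc N \<in> T (i, j)"
    then show "i \<in> shared_rows N T \<and> Suc j = inner_shape N T i"
      using * j less_inner_shape_iff[OF T] unfolding shared_rows_def by blast
  next
    assume r: "i \<in> shared_rows N T \<and> Suc j = inner_shape N T i"
    then obtain k where "T (i, k) \<inter> {..N} \<noteq> {}" and k: "Suc N \<in> T (i, k)"
      unfolding shared_rows_def by blast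
    then have "Suc k = inner_shape N T i" using * less_inner_shape_iff[OF T] by blast
    with r k show "Suc N \<in> T (i, j)" by (metis Suc_inject)
  qed
qed

lemma inner_shape_le:
  assumes T: "T \<in> svt (Suc N) \<mu>"
  shows "inner_shape N T i \<le> \<mu> i"
proof -
  have "j < \<mu> i" if "j < inner_shape N T i" for j
    using that svt_nonempty_iff[OF T, of i j] unfolding less_inner_shape_iff[OF T] by blast
  then show ?thesis by (meson not_le_imp_less less_irrefl)
qed

text \<open>A box of \<mu> with another box below it has entries smaller than an entry that is at
  most \<open>Suc N\<close>.\<close>

lemma le_inner_shape:
  assumes T: "T \<in> svt (Suc N) \<mu>"
  shows "\<mu> (Suc i) \<le> inner_shape N T i"
proof -
  have "j < inner_shape N T i" if j: "j < \<mu> (Suc i)" for j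
  proof -
    have "\<mu> (Suc i) \<le> \<mu> i" using anti by (simp add: antimonoD)
    then have "j < \<mu> i" using j by simp
    then obtain s where s: "s \<in> T (i, j)" using svt_nonempty_iff[OF T, of i j] by blast
    obtain t where t: "t \<in> T (Suc i, j)" using j svt_nonempty_iff[OF T, of "Suc i" j] by blast
    have "t \<le> Suc N" using t svt_subset[OF T, of "Suc i" j] by auto
    moreover have "s < t" using svt_column[OF T, of i "Suc i"] s t by blast
    ultimately show ?thesis using s less_inner_shape_iff[OF T] by auto
  qed
  then show ?thesis by (meson not_le_imp_less less_irrefl)
qed

lemma inner_shape_interlacing:
  assumes T: "T \<in> svt (Suc N) \<mu>"
  shows "inner_shape N T \<in> interlacing N \<mu>"
proof -
  have "inner_shape N T i = 0" if "i \<ge> N" for i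
  proof (rule ccontr)
    assume "inner_shape N T i \<noteq> 0"
    then obtain s where "s \<in> T (i, 0)" "s \<le> N"
      using less_inner_shape_iff[OF T, of 0 i] by auto
    with svt_entry_gt_row[OF T anti] that show False by fastforce
  qed
  then show ?thesis
    using inner_shape_le[OF T] le_inner_shape[OF T] by (auto simp: interlacing_def)
qed

lemma shared_rows_subset:
  assumes T: "T \<in> svt (Suc N) \<mu>"
  shows "shared_rows N T \<subseteq> free_rows N \<mu> (inner_shape N T)"
proof
  fix i assume i: "i \<in> shared_rows N T"
  then obtain j where j: "j < inner_shape N T i" and S: "Suc N \<in> T (i, j)"
    unfolding shared_rows_def using less_inner_shape_iff[OF T] by blast
  then have eq: "Suc j = inner_shape N T i" using Suc_in_svt_iff[OF T] by blast
  have "i < N"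
    using j inner_shape_interlacing[OF T] by (force simp: interlacing_def not_less[symmetric])
  moreover have "\<not> j < \<mu> (Suc i)"
  proof
    assume "j < \<mu> (Suc i)"
    then obtain t where t: "t \<in> T (Suc i, j)" using svt_nonempty_iff[OF T, of "Suc i" j] by blast
    have "t \<le> Suc N" using t svt_subset[OF T, of "Suc i" j] by auto
    moreover have "Suc N < t" using svt_column[OF T _ S t] by simp
    ultimately show False by simp
  qed
  ultimately show "i \<in> free_rows N \<mu> (inner_shape N T)"
    using eq by (auto simp: free_rows_def)
qed

lemma restrict_svt:
  assumes T: "T \<in> svt (Suc N) \<mu>"
  shows "(\<lambda>b. T b \<inter> {..N}) \<in> svt N (inner_shape N T)"
proof -
  show ?thesis
  proof (rule svtI)
    show "T (i, j) \<inter> {..N} \<subseteq> {1..N}" for i j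
      using svt_subset[OF T, of i j] by auto
  qed (auto simp: less_inner_shape_iff[OF T] dest: svt_row[OF T] svt_column[OF T])
qed

lemma glue_restrict:
  assumes T: "T \<in> svt (Suc N) \<mu>"
  shows "glue N \<mu> (inner_shape N T) (\<lambda>b. T b \<inter> {..N}) (shared_rows N T) = T"
proof (intro ext, clarify)
  fix i j
  have split: "T (i, j) = T (i, j) \<inter> {..N} \<union> (if Suc N \<in> T (i, j) then {Suc N} else {})"
    using svt_subset[OF T, of i j] by (auto simp: subset_iff le_Suc_eq)
  show "glue N \<mu> (inner_shape N T) (\<lambda>b. T b \<inter> {..N}) (shared_rows N T) (i, j) = T (i, j)"
  proof (cases "j < inner_shape N T i")
    case True
    then show ?thesis
      using split Suc_in_svt_iff[OF T True] by (simp add: glue_def)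
  next
    case False
    then have "T (i, j) \<inter> {..N} = {}" using less_inner_shape_iff[OF T] by blast
    moreover have "j < \<mu> i \<longleftrightarrow> T (i, j) \<noteq> {}" using svt_nonempty_iff[OF T] by blast
    moreover from calculation(1) split have "T (i, j) = (if Suc N \<in> T (i, j) then {Suc N} else {})"
      by simp
    ultimately show ?thesis
      using False by (cases "Suc N \<in> T (i, j)") (simp_all add: glue_def)
  qed
qed

lemma glue_Int:
  assumes T: "T \<in> svt N \<nu>"
  shows "glue N \<mu> \<nu> T U b \<inter> {..N} = T b"
proof -
  obtain i j where b: "b = (i, j)" by (cases b)
  have "T (i, j) \<subseteq> {..N}"
    using svt_subset[OF T, of i j] by auto
  moreover have "\<not> j < \<nu> i \<Longrightarrow> T (i, j) = {}"
    using svt_nonempty_iff[OF T, of i j] by blast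
  ultimately show ?thesis
    by (auto simp: b glue_def)
qed

lemma inner_shape_glue:
  assumes T: "T \<in> svt N \<nu>"
  shows "inner_shape N (glue N \<mu> \<nu> T U) = \<nu>"
proof
  fix i
  have "{j. T (i, j) \<noteq> {}} = {..<\<nu> i}" using svt_nonempty_iff[OF T] by blast
  then show "inner_shape N (glue N \<mu> \<nu> T U) i = \<nu> i"
    by (simp add: inner_shape_def glue_Int[OF T])
qed

lemma Suc_in_glue_iff:
  assumes T: "T \<in> svt N \<nu>"
  shows "Suc N \<in> glue N \<mu> \<nu> T U (i, j) \<longleftrightarrow>
    (if j < \<nu> i then i \<in> U \<and> Suc j = \<nu> i else j < \<mu> i)"
proof -
  have "T (i, j) \<subseteq> {..N}"
    using svt_subset[OF T, of i j] by auto
  then show ?thesis by (auto simp: glue_def)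
qed

lemma shared_rows_glue:
  assumes T: "T \<in> svt N \<nu>" and U: "U \<subseteq> free_rows N \<mu> \<nu>"
  shows "shared_rows N (glue N \<mu> \<nu> T U) = U"
proof -
  have "j < \<nu> i \<longleftrightarrow> T (i, j) \<noteq> {}" for i j using svt_nonempty_iff[OF T] by blast
  then have "shared_rows N (glue N \<mu> \<nu> T U) = {i. \<exists>j. j < \<nu> i \<and> i \<in> U \<and> Suc j = \<nu> i}"
    by (auto simp: shared_rows_def glue_Int[OF T] Suc_in_glue_iff[OF T])
  also have "\<dots> = U"
  proof -
    have "\<exists>j<\<nu> i. Suc j = \<nu> i" if "i \<in> U" for i
    proof -
      have "\<mu> (Suc i) < \<nu> i" using that U by (auto simp: free_rows_def)
      then show ?thesis by (intro exI[of _ "\<nu> i - 1"]) simp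
    qed
    then show ?thesis by blast
  qed
  finally show ?thesis .
qed

lemma interlacing_le:
  assumes "\<nu> \<in> interlacing N \<mu>"
  shows "\<nu> i \<le> \<mu> i" "\<mu> (Suc i) \<le> \<nu> i"
  using assms len[of "Suc i"] unfolding interlacing_def by (cases "i < N"; simp)+

lemma glue_svt:
  assumes \<nu>: "\<nu> \<in> interlacing N \<mu>" and T: "T \<in> svt N \<nu>" and U: "U \<subseteq> free_rows N \<mu> \<nu>"
  shows "glue N \<mu> \<nu> T U \<in> svt (Suc N) \<mu>"
proof -
  let ?G = "glue N \<mu> \<nu> T U"
  note le = interlacing_le[OF \<nu>]
  have Tsub: "T (i, j) \<subseteq> {1..N}" and Tne: "T (i, j) \<noteq> {} \<longleftrightarrow> j < \<nu> i" for i j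
    using svt_subset[OF T] svt_nonempty_iff[OF T] by blast+
  have Gsub: "?G (i, j) \<subseteq> insert (Suc N) (T (i, j))" for i j
    by (auto simp: glue_def)
  have Gne: "?G (i, j) \<noteq> {} \<longleftrightarrow> j < \<mu> i" for i j
    using Tne le[of i] by (auto simp: glue_def)
  have Gsub': "?G (i, j) \<subseteq> {1..Suc N}" for i j
    using Gsub[of i j] Tsub[of i j] by force
  have Grow: "s \<le> t" if jk: "j < k" and s: "s \<in> ?G (i, j)" and t: "t \<in> ?G (i, k)" for i j k s t
  proof (cases "t = Suc N")
    case True
    then show ?thesis using s Gsub[of i j] Tsub[of i j] by fastforce
  next
    case False
    then have t': "t \<in> T (i, k)" using t Gsub by blast
    then have k: "k < \<nu> i" using Tne by blast
    then have "Suc N \<notin> ?G (i, j)" using jk by (simp add: Suc_in_glue_iff[OF T])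
    then have "s \<in> T (i, j)" using s Gsub by blast
    then show ?thesis using svt_row[OF T jk] t' by blast
  qed
  \<comment> \<open>A box of \<mu> below forces the upper box to lie in \<nu>, by interlacing, and
    not to be the last box of a row in \<open>U\<close>, since these rows are free. Therefore the
    upper box does not contain \<open>Suc N\<close>.\<close>
  have Gcol: "s < t" if ik: "i < k" and s: "s \<in> ?G (i, j)" and t: "t \<in> ?G (k, j)" for i j k s t
  proof -
    have "j < \<mu> k" using t Gne by blast
    also have "\<mu> k \<le> \<mu> (Suc i)" using anti ik by (simp add: antimonoD)
    finally have j: "j < \<mu> (Suc i)" .
    then have "j < \<nu> i" using le[of i] by simp
    moreover have "\<not> (i \<in> U \<and> Suc j = \<nu> i)" using U j by (auto simp: free_rows_def)
    ultimately have "Suc N \<notin> ?G (i, j)" by (simp add: Suc_in_glue_iff[OF T])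
    then have s': "s \<in> T (i, j)" using s Gsub by blast
    show ?thesis
    proof (cases "t = Suc N")
      case True
      then show ?thesis using s' Tsub[of i j] by fastforce
    next
      case False
      then have "t \<in> T (k, j)" using t Gsub by blast
      then show ?thesis using svt_column[OF T ik] s' by blast
    qed
  qed
  show ?thesis
    by (rule svtI[OF Gne Gsub' Grow Gcol])
qed

text \<open>A box outside \<nu> contains only \<open>Suc N\<close> and has weight
  \<open>X (Suc N)\<close>; joining \<open>Suc N\<close> to a nonempty box multiplies its weight by
  \<open>\<beta> * X (Suc N)\<close>. The sum includes row \<open>N\<close>, which may be nonempty
  in \<mu> but is empty in \<nu>.\<close>

lemma weight_glue:
  assumes \<nu>: "\<nu> \<in> interlacing N \<mu>" and T: "T \<in> svt N \<nu>" and U: "U \<subseteq> free_rows N \<mu> \<nu>"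
  shows "(\<Prod>b\<in>boxes \<mu>. box_weight \<beta> (glue N \<mu> \<nu> T U b)) =
    X (Suc N) ^ (\<Sum>i\<le>N. \<mu> i - \<nu> i) * (\<beta> * X (Suc N)) ^ card U * (\<Prod>b\<in>boxes \<nu>. box_weight \<beta> (T b))"
proof -
  let ?G = "glue N \<mu> \<nu> T U" and ?y = "X (Suc N)"
  note le = interlacing_le[OF \<nu>]
  have sub: "boxes \<nu> \<subseteq> boxes \<mu>" using le by (force simp: boxes_def intro: less_le_trans)
  have fin: "finite (boxes \<mu>)" using len by (intro finite_boxes[of "Suc N"]) auto
  have finU: "finite U" using U by (rule finite_subset) (simp add: free_rows_def)
  have "(\<Prod>b\<in>boxes \<mu>. box_weight \<beta> (?G b)) =
      (\<Prod>b\<in>boxes \<mu> - boxes \<nu>. box_weight \<beta> (?G b)) * (\<Prod>b\<in>boxes \<nu>. box_weight \<beta> (?G b))"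
    using prod.subset_diff[OF sub fin] .
  also have "(\<Prod>b\<in>boxes \<mu> - boxes \<nu>. box_weight \<beta> (?G b)) = (\<Prod>b\<in>boxes \<mu> - boxes \<nu>. ?y)"
    by (rule prod.cong) (auto simp: boxes_def glue_def box_weight_def)
  also have "\<dots> = ?y ^ (\<Sum>i\<le>N. \<mu> i - \<nu> i)"
  proof -
    have "boxes \<mu> - boxes \<nu> = Sigma {..N} (\<lambda>i. {\<nu> i..<\<mu> i})"
      using len by (force simp: boxes_def not_less[symmetric])
    then show ?thesis by simp
  qed
  also have "(\<Prod>b\<in>boxes \<nu>. box_weight \<beta> (?G b)) =
      (\<Prod>b\<in>boxes \<nu>. (if b \<in> (\<lambda>i. (i, \<nu> i - 1)) ` U then \<beta> * ?y else 1) * box_weight \<beta> (T b))"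
  proof (rule prod.cong[OF refl])
    fix b assume b: "b \<in> boxes \<nu>"
    then obtain i j where ij: "b = (i, j)" "j < \<nu> i" by (auto simp: boxes_def)
    have img: "b \<in> (\<lambda>i. (i, \<nu> i - 1)) ` U \<longleftrightarrow> i \<in> U \<and> Suc j = \<nu> i"
      using ij by auto
    have T': "T (i, j) \<noteq> {}" "T (i, j) \<subseteq> {1..N}"
      using ij svt_nonempty_iff[OF T] svt_subset[OF T] by blast+
    then have fT: "finite (T (i, j))" and "Suc N \<notin> T (i, j)" and "card (T (i, j)) > 0"
      by (auto simp: finite_subset card_gt_0_iff)
    \<comment> \<open>Since the old cardinality is a successor, the truncated difference in
      \<open>box_weight\<close> grows by exactly one when \<open>Suc N\<close> is added.\<close>
    then obtain c where "card (T (i, j)) = Suc c" by (metis gr0_implies_Suc)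
    then show "box_weight \<beta> (?G b) =
        (if b \<in> (\<lambda>i. (i, \<nu> i - 1)) ` U then \<beta> * ?y else 1) * box_weight \<beta> (T b)"
      using ij fT \<open>Suc N \<notin> T (i, j)\<close>
      by (simp only: img) (auto simp: glue_def box_weight_def algebra_simps)
  qed
  also have "\<dots> = (\<beta> * ?y) ^ card U * (\<Prod>b\<in>boxes \<nu>. box_weight \<beta> (T b))"
  proof -
    have inj: "inj_on (\<lambda>i. (i, \<nu> i - 1)) U" by (auto simp: inj_on_def)
    have "boxes \<nu> \<inter> (\<lambda>i. (i, \<nu> i - 1)) ` U = (\<lambda>i. (i, \<nu> i - 1)) ` U"
      using U by (auto simp: boxes_def free_rows_def)
    then have "(\<Prod>b\<in>boxes \<nu>. if b \<in> (\<lambda>i. (i, \<nu> i - 1)) ` U then \<beta> * ?y else 1) = (\<beta> * ?y) ^ card U"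
      using inj finite_subset[OF sub fin] by (simp add: prod.inter_restrict[symmetric] card_image)
    then show ?thesis by (simp add: prod.distrib)
  qed
  finally show ?thesis by (simp add: mult.assoc)
qed

lemma sum_power_card_Pow:
  assumes "finite C"
  shows "(\<Sum>U\<in>Pow C. z ^ card U) = (1 + z :: 'b :: comm_ring_1) ^ card C"
  using prod_add[OF assms, of "\<lambda>_. z" "\<lambda>_. 1"] by (simp add: add.commute)

text \<open>Tableaux correspond to triples of an interlacing shape, a tableau of that shape and an
  arbitrary set \<open>U\<close> of free rows. Summing over \<open>U\<close> gives one factor
  \<open>1 + \<beta> * X (Suc N)\<close> for each free row.\<close>

lemma tableau_sum_branching:
  "tableau_sum \<beta> (Suc N) \<mu> = (\<Sum>\<nu>\<in>interlacing N \<mu>.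
     X (Suc N) ^ (\<Sum>i\<le>N. \<mu> i - \<nu> i) * (1 + \<beta> * X (Suc N)) ^ card (free_rows N \<mu> \<nu>) *
     tableau_sum \<beta> N \<nu>)"
proof -
  let ?y = "X (Suc N)"
  let ?w = "\<lambda>\<nu> T. \<Prod>b\<in>boxes \<nu>. box_weight \<beta> (T b)"
  let ?S = "Sigma (interlacing N \<mu>) (\<lambda>\<nu>. svt N \<nu> \<times> Pow (free_rows N \<mu> \<nu>))"
  have fin: "finite (svt N \<nu>)" if "\<nu> \<in> interlacing N \<mu>" for \<nu>
    using that by (intro finite_svt finite_boxes[of N]) (auto simp: interlacing_def)
  have fin': "finite (free_rows N \<mu> \<nu>)" for \<nu> by (simp add: free_rows_def)
  have decompose: "?y ^ (\<Sum>i\<le>N. \<mu> i - inner_shape N T i) * (\<beta> * ?y) ^ card (shared_rows N T) *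
      ?w (inner_shape N T) (\<lambda>b. T b \<inter> {..N}) = ?w \<mu> T" if T: "T \<in> svt (Suc N) \<mu>" for T
    using weight_glue[OF inner_shape_interlacing[OF T] restrict_svt[OF T] shared_rows_subset[OF T],
        of \<beta>] by (simp only: glue_restrict[OF T])
  have "tableau_sum \<beta> (Suc N) \<mu> = (\<Sum>(\<nu>, T, U)\<in>?S.
      ?y ^ (\<Sum>i\<le>N. \<mu> i - \<nu> i) * (\<beta> * ?y) ^ card U * ?w \<nu> T)"
    unfolding tableau_sum_def
    by (rule sum.reindex_bij_witness[where
          i = "\<lambda>(\<nu>, T, U). glue N \<mu> \<nu> T U" and
          j = "\<lambda>T. (inner_shape N T, (\<lambda>b. T b \<inter> {..N}), shared_rows N T)"])
      (auto simp: glue_restrict inner_shape_interlacing restrict_svt glue_Int inner_shape_glue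
        shared_rows_glue glue_svt decompose dest: subsetD[OF shared_rows_subset])
  also have "\<dots> = (\<Sum>\<nu>\<in>interlacing N \<mu>. \<Sum>T\<in>svt N \<nu>. \<Sum>U\<in>Pow (free_rows N \<mu> \<nu>).
      ?y ^ (\<Sum>i\<le>N. \<mu> i - \<nu> i) * (\<beta> * ?y) ^ card U * ?w \<nu> T)"
    unfolding sum.cartesian_product
    by (rule sum.Sigma[symmetric]) (use fin fin' finite_interlacing in auto)
  also have "\<dots> = (\<Sum>\<nu>\<in>interlacing N \<mu>. ?y ^ (\<Sum>i\<le>N. \<mu> i - \<nu> i) *
      (1 + \<beta> * ?y) ^ card (free_rows N \<mu> \<nu>) * tableau_sum \<beta> N \<nu>)"
    by (simp add: tableau_sum_def sum_distrib_left[symmetric] sum_distrib_right[symmetric]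
        sum_power_card_Pow[OF fin', symmetric])
  finally show ?thesis .
qed

end

section \<open>Bialternant formula\<close>

text \<open>The product of all \<open>X (Suc i) - X (Suc j)\<close> with \<open>i < j < N\<close>,
  arranged so that a new variable contributes precisely the factor split off in
  \<open>bialternant_Suc\<close>.\<close>

primrec vandermonde :: "nat \<Rightarrow> pseries" where
  "vandermonde 0 = 1"
| "vandermonde (Suc N) = vandermonde N * (\<Prod>i<N. X (Suc i) - X (Suc N))"

lemma vandermonde_cancel:
  assumes "vandermonde N * f = vandermonde N * g"
  shows "f = g"
  using assms
proof (induction N arbitrary: f g)
  case (Suc N)
  have *: "f = g" if "finite A" "Suc N \<notin> Suc ` A"
    "(\<Prod>i\<in>A. X (Suc i) - X (Suc N)) * f = (\<Prod>i\<in>A. X (Suc i) - X (Suc N)) * g" for A f g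
    using that
  proof (induction A arbitrary: f g rule: finite_induct)
    case (insert i A)
    show ?case
    proof (rule insert.IH)
      show "(\<Prod>i\<in>A. X (Suc i) - X (Suc N)) * f = (\<Prod>i\<in>A. X (Suc i) - X (Suc N)) * g"
        by (rule X_diff_cancel[of "Suc i" "Suc N"]) (use insert in \<open>auto simp: mult.assoc\<close>)
    qed (use insert in auto)
  qed simp
  from Suc.prems have "(\<Prod>i<N. X (Suc i) - X (Suc N)) * f = (\<Prod>i<N. X (Suc i) - X (Suc N)) * g"
    by (intro Suc.IH[of "_ * f"]) (simp add: mult.assoc)
  then show ?case by (rule *[rotated 2]) auto
qed simp

text \<open>For \<open>\<beta> = 0\<close> this is the classical numerator of a Schur polynomial,
  for \<open>\<beta> = 1\<close> that of a Grothendieck polynomial. Columns are counted from 0,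
  whence the exponents \<open>N - Suc j\<close> and \<open>j\<close>.\<close>

definition bialternant :: "pseries \<Rightarrow> nat \<Rightarrow> (nat \<Rightarrow> nat) \<Rightarrow> pseries" where
  "bialternant \<beta> N \<mu> =
     alternant (\<lambda>i. X (Suc i)) N (\<lambda>j y. y ^ (\<mu> j + (N - Suc j)) * (1 + \<beta> * y) ^ j)"

text \<open>A variant of the geometric sum: from \<open>e\<close> to \<open>Suc e\<close>, the sum
  is multiplied by \<open>y\<close> and gains the term \<open>(1 + \<beta> * y) * z ^ Suc e\<close>.
  Only \<open>c = 0\<close> lacks the extra factor, just like the rows that are not free in the
  branching rule.\<close>

lemma divided_difference:
  fixes z y \<beta> :: "'a :: comm_ring_1"
  shows "(1 + \<beta> * y) * z ^ Suc e - (1 + \<beta> * z) * y ^ Suc e =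
    (z - y) * (\<Sum>c\<le>e. (if c = 0 then 1 else 1 + \<beta> * y) * (z ^ c * y ^ (e - c)))"
proof (induction e)
  case 0
  then show ?case by (simp add: algebra_simps)
next
  case (Suc e)
  let ?S = "\<lambda>e. \<Sum>c\<le>e. (if c = 0 then 1 else 1 + \<beta> * y) * (z ^ c * y ^ (e - c))"
  have "?S (Suc e) = y * ?S e + (1 + \<beta> * y) * z ^ Suc e"
    by (simp add: sum_distrib_left Suc_diff_le algebra_simps)
  then have "(z - y) * ?S (Suc e) = y * ((z - y) * ?S e) + (z - y) * ((1 + \<beta> * y) * z ^ Suc e)"
    by (simp only: algebra_simps)
  also have "\<dots> = (1 + \<beta> * y) * z ^ Suc (Suc e) - (1 + \<beta> * z) * y ^ Suc (Suc e)"
    unfolding Suc.IH[symmetric] by (simp add: algebra_simps)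
  finally show ?case ..
qed

lemma tableau_sum_zero:
  assumes "\<And>i. \<mu> i = 0"
  shows "tableau_sum \<beta> N \<mu> = 1"
proof -
  have "T = (\<lambda>_. {})" if T: "T \<in> svt N \<mu>" for T
    using svt_nonempty_iff[OF T] assms by auto
  then have "svt N \<mu> = {\<lambda>_. {}}" by (auto intro!: svtI simp: assms)
  then show ?thesis by (simp add: tableau_sum_def boxes_def assms)
qed

lemma interlacing_antimono:
  assumes "antimono \<mu>" "\<nu> \<in> interlacing N \<mu>"
  shows "antimono \<nu>"
  unfolding antimono_iff_le_Suc
proof
  fix i
  show "\<nu> (Suc i) \<le> \<nu> i"
    using assms(2) order_trans[of "\<nu> (Suc i)" "\<mu> (Suc i)" "\<nu> i"]
    by (cases "Suc i < N") (auto simp: interlacing_def)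
qed

text \<open>The rows of an interlacing shape vary independently in intervals, which is the index set
  produced by multilinear expansion. Only the convention for arguments from \<open>N\<close> on has
  to be changed.\<close>

lemma sum_PiE_interlacing:
  "(\<Sum>m\<in>Pi\<^sub>E {..<N} (\<lambda>j. {\<mu> (Suc j)..\<mu> j}). F (\<lambda>i. if i < N then m i else 0)) =
   (\<Sum>\<nu>\<in>interlacing N \<mu>. F \<nu>)"
  by (rule sum.reindex_bij_witness[where i = "\<lambda>\<nu>. restrict \<nu> {..<N}"
        and j = "\<lambda>m i. if i < N then m i else 0"])
    (auto simp: interlacing_def PiE_def extensional_def fun_eq_iff Pi_iff)

text \<open>Subtracting a multiple of the next column from each column makes the last row zero up to its
  last entry. The other entries become divisible by \<open>x\<^sub>i - y\<close>, and the quotients expand over the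
  interlacing shapes.\<close>

lemma bialternant_Suc:
  assumes anti: "antimono \<mu>"
    and cancel: "\<And>f g. (1 + \<beta> * X (Suc N)) * f = (1 + \<beta> * X (Suc N)) * g \<Longrightarrow> f = g"
  shows "bialternant \<beta> (Suc N) \<mu> = (\<Prod>i<N. X (Suc i) - X (Suc N)) *
    (\<Sum>\<nu>\<in>interlacing N \<mu>. X (Suc N) ^ (\<Sum>i\<le>N. \<mu> i - \<nu> i) *
      (1 + \<beta> * X (Suc N)) ^ card (free_rows N \<mu> \<nu>) * bialternant \<beta> N \<nu>)"
proof -
  define y where "y = X (Suc N)"
  define x where "x = (\<lambda>i. X (Suc i))"
  define f where "f = (\<lambda>j z. z ^ (\<mu> j + (N - j)) * (1 + \<beta> * z) ^ j)"
  define d where "d = (\<lambda>j. Suc (\<mu> j - \<mu> (Suc j)))"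
  \<comment> \<open>The multipliers make both terms equal to
    \<open>y ^ (\<mu> j + (N - j)) * (1 + \<beta> * y) ^ Suc j\<close> at \<open>z = y\<close>, so
    that the difference vanishes there.\<close>
  define g where "g = (\<lambda>j z. if j < N then (1 + \<beta> * y) * f j z - y ^ d j * f (Suc j) z else f j z)"
  define u where "u = (\<lambda>c j. if c = j then (if j < N then 1 + \<beta> * y else 1)
     else if c = Suc j then - (y ^ d j) else (0 :: pseries))"
  \<comment> \<open>The weight that row \<open>j\<close> contributes to the branching rule when its
    new length is \<open>c\<close>; the second factor appears exactly if that row is free.\<close>
  define k where "k = (\<lambda>j c. y ^ (\<mu> j - c) * (if \<mu> (Suc j) < c then 1 + \<beta> * y else 1))"
  define h where "h = (\<lambda>j c z. z ^ (c + (N - Suc j)) * (1 + \<beta> * z) ^ j)"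
  have le: "\<mu> (Suc j) \<le> \<mu> j" for j using anti by (simp add: antimono_iff_le_Suc)
  have xN: "x N = y" by (simp add: x_def y_def)
  have g_factor: "g j z = (z - y) * (\<Sum>c\<in>{\<mu> (Suc j)..\<mu> j}. k j c * h j c z)" if j: "j < N" for j z
  proof -
    define e where "e = \<mu> j - \<mu> (Suc j)"
    define b where "b = \<mu> (Suc j) + (N - Suc j)"
    have "\<mu> j + (N - j) = b + Suc e" using j le[of j] by (simp add: e_def b_def)
    then have fj: "f j z = z ^ (b + Suc e) * (1 + \<beta> * z) ^ j" by (simp only: f_def)
    have fSj: "f (Suc j) z = z ^ b * (1 + \<beta> * z) ^ Suc j" by (simp only: f_def b_def)
    have "g j z = (1 + \<beta> * z) ^ j * z ^ b * ((1 + \<beta> * y) * z ^ Suc e - (1 + \<beta> * z) * y ^ Suc e)"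
      using j by (simp add: g_def fj fSj d_def e_def[symmetric] power_add algebra_simps)
    also have "\<dots> = (z - y) * (\<Sum>c\<le>e. (1 + \<beta> * z) ^ j * z ^ b *
        ((if c = 0 then 1 else 1 + \<beta> * y) * (z ^ c * y ^ (e - c))))"
      unfolding divided_difference
      by (simp only: sum_distrib_left[symmetric] mult.left_commute[of _ "z - y"])
    also have "(\<Sum>c\<le>e. (1 + \<beta> * z) ^ j * z ^ b * ((if c = 0 then 1 else 1 + \<beta> * y) * (z ^ c * y ^ (e - c)))) =
        (\<Sum>c\<in>{\<mu> (Suc j)..\<mu> j}. k j c * h j c z)"
      by (rule sum.reindex_bij_witness[where i = "\<lambda>c. c - \<mu> (Suc j)" and j = "\<lambda>c. c + \<mu> (Suc j)"])
        (use le[of j] in \<open>auto simp: e_def k_def h_def b_def power_add mult_ac add_ac\<close>)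
    finally show ?thesis .
  qed
  have "(1 + \<beta> * y) ^ N * alternant x (Suc N) f = alternant x (Suc N) g"
  proof -
    have "alternant x (Suc N) g = (\<Prod>j<Suc N. u j j) * alternant x (Suc N) f"
    proof (rule alternant_column_operation[where u = u])
      show "(\<forall>c<Suc N. \<forall>j<c. u c j = 0) \<or> (\<forall>j<Suc N. \<forall>c<j. u c j = 0)"
        by (auto simp: u_def)
    next
      fix i j assume "j < Suc N"
      have "(\<Sum>c<Suc N. f c (x i) * u c j) = (\<Sum>c\<in>(if j < N then {j, Suc j} else {j}). f c (x i) * u c j)"
        by (rule sum.mono_neutral_right) (use \<open>j < Suc N\<close> in \<open>auto simp: u_def\<close>)
      also have "\<dots> = g j (x i)"
        by (auto simp: u_def g_def algebra_simps)
      finally show "g j (x i) = (\<Sum>c<Suc N. f c (x i) * u c j)" ..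
    qed
    also have "(\<Prod>j<Suc N. u j j) = (1 + \<beta> * y) ^ N" by (simp add: u_def)
    finally show ?thesis ..
  qed
  also have "\<dots> = g N y * alternant x N g"
    unfolding xN[symmetric] by (rule alternant_last_row) (simp add: g_factor xN)
  also have "g N y = (1 + \<beta> * y) ^ N * y ^ \<mu> N" by (simp add: g_def f_def)
  also have "alternant x N g = alternant x N (\<lambda>j z. (z - y) * (\<Sum>c\<in>{\<mu> (Suc j)..\<mu> j}. k j c * h j c z))"
    by (rule alternant_cong) (simp add: g_factor)
  also have "\<dots> = (\<Prod>i<N. x i - y) * (\<Sum>m\<in>Pi\<^sub>E {..<N} (\<lambda>j. {\<mu> (Suc j)..\<mu> j}).
      (\<Prod>j<N. k j (m j)) * alternant x N (\<lambda>j. h j (m j)))"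
    unfolding alternant_scale_rows by (subst alternant_sum_columns) (simp_all add: alternant_scale_columns)
  also have "(\<Sum>m\<in>Pi\<^sub>E {..<N} (\<lambda>j. {\<mu> (Suc j)..\<mu> j}).
      (\<Prod>j<N. k j (m j)) * alternant x N (\<lambda>j. h j (m j))) =
      (\<Sum>\<nu>\<in>interlacing N \<mu>. (\<Prod>j<N. k j (\<nu> j)) * alternant x N (\<lambda>j. h j (\<nu> j)))"
    unfolding sum_PiE_interlacing[symmetric]
    by (intro sum.cong refl arg_cong2[where f = "(*)"] prod.cong alternant_cong) simp_all
  finally have eq: "(1 + \<beta> * y) ^ N * alternant x (Suc N) f = (1 + \<beta> * y) ^ N *
      ((\<Prod>i<N. x i - y) * (\<Sum>\<nu>\<in>interlacing N \<mu>. y ^ \<mu> N * (\<Prod>j<N. k j (\<nu> j)) * alternant x N (\<lambda>j. h j (\<nu> j))))"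
    by (simp add: sum_distrib_left mult_ac)
  \<comment> \<open>The power of \<open>1 + \<beta> * y\<close> comes on the left from the diagonal
    of \<open>u\<close>, on the right from the last entry of the last row.\<close>
  have pow_cancel: "f = g" if "(1 + \<beta> * y) ^ n * f = (1 + \<beta> * y) ^ n * g" for n f g
    using that by (induction n) (auto simp: mult.assoc y_def dest: cancel)
  have "(\<Prod>j<N. k j (\<nu> j)) * y ^ \<mu> N = y ^ (\<Sum>i\<le>N. \<mu> i - \<nu> i) * (1 + \<beta> * y) ^ card (free_rows N \<mu> \<nu>)"
    if "\<nu> \<in> interlacing N \<mu>" for \<nu>
  proof -
    have "free_rows N \<mu> \<nu> = {..<N} \<inter> {j. \<mu> (Suc j) < \<nu> j}" by (auto simp: free_rows_def)
    then have "(\<Prod>j<N. if \<mu> (Suc j) < \<nu> j then 1 + \<beta> * y else 1) = (1 + \<beta> * y) ^ card (free_rows N \<mu> \<nu>)"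
      using prod.inter_restrict[of "{..<N}" "\<lambda>_. 1 + \<beta> * y" "{j. \<mu> (Suc j) < \<nu> j}"] by simp
    moreover have "(\<Sum>i\<le>N. \<mu> i - \<nu> i) = (\<Sum>i<N. \<mu> i - \<nu> i) + \<mu> N"
      using that by (simp add: lessThan_Suc_atMost[symmetric] interlacing_def)
    ultimately show ?thesis
      by (simp add: k_def prod.distrib power_sum power_add mult_ac)
  qed
  then have "alternant x (Suc N) f = (\<Prod>i<N. x i - y) * (\<Sum>\<nu>\<in>interlacing N \<mu>.
      y ^ (\<Sum>i\<le>N. \<mu> i - \<nu> i) * (1 + \<beta> * y) ^ card (free_rows N \<mu> \<nu>) * alternant x N (\<lambda>j. h j (\<nu> j)))"
    using pow_cancel[OF eq] by (simp add: mult_ac cong: sum.cong)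
  then show ?thesis
    by (simp add: bialternant_def x_def y_def f_def h_def)
qed

text \<open>Both sides satisfy the same recursion when a variable is added, and both are 1 without
  variables. The two values of \<beta> are those for which cancelling
  \<open>1 + \<beta> * X (Suc N)\<close> has been justified.\<close>

lemma bialternant_formula:
  assumes "antimono \<mu>" "\<And>i. i \<ge> N \<Longrightarrow> \<mu> i = 0" "\<beta> = 0 \<or> \<beta> = 1"
  shows "bialternant \<beta> N \<mu> = vandermonde N * tableau_sum \<beta> N \<mu>"
  using assms(1,2)
proof (induction N arbitrary: \<mu>)
  case 0
  then show ?case by (simp add: bialternant_def tableau_sum_zero)
next
  case (Suc N)
  have "bialternant \<beta> N \<nu> = vandermonde N * tableau_sum \<beta> N \<nu>" if "\<nu> \<in> interlacing N \<mu>" for \<nu>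
    using interlacing_antimono[OF Suc.prems(1) that] that
    by (intro Suc.IH) (auto simp: interlacing_def)
  moreover have "f = g" if "(1 + \<beta> * X (Suc N)) * f = (1 + \<beta> * X (Suc N)) * g" for f g
    using that assms(3) by (auto dest: one_plus_X_cancel)
  ultimately have "bialternant \<beta> (Suc N) \<mu> = (\<Prod>i<N. X (Suc i) - X (Suc N)) *
    (\<Sum>\<nu>\<in>interlacing N \<mu>. X (Suc N) ^ (\<Sum>i\<le>N. \<mu> i - \<nu> i) *
      (1 + \<beta> * X (Suc N)) ^ card (free_rows N \<mu> \<nu>) * (vandermonde N * tableau_sum \<beta> N \<nu>))"
    by (subst bialternant_Suc[OF Suc.prems(1)]) (simp_all cong: sum.cong)
  also have "\<dots> = vandermonde (Suc N) * tableau_sum \<beta> (Suc N) \<mu>"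
    by (subst tableau_sum_branching[OF Suc.prems(1)]) (use Suc.prems(2) in \<open>auto simp: sum_distrib_left mult_ac\<close>)
  finally show ?case .
qed

section \<open>Truncations of \<open>Gt\<close> and \<open>schur\<close> as tableau sums\<close>

definition parts :: "nat list \<Rightarrow> nat \<Rightarrow> nat" where
  "parts l i = (if i < length l then l ! i else 0)"

lemma boxes_parts: "boxes (parts l) = diagram l"
  by (auto simp: boxes_def diagram_def parts_def split: if_splits)

lemma less_parts_iff: "j < parts l i \<longleftrightarrow> (i, j) \<in> diagram l"
  by (auto simp: diagram_def parts_def split: if_splits)

lemma finite_diagram: "finite (diagram l)"
  unfolding boxes_parts[symmetric] by (rule finite_boxes[of "length l"]) (simp add: parts_def)

lemma svt_imp_set_valued:
  assumes T: "T \<in> svt N (parts l)"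
  shows "T \<in> set_valued_tableaux l"
proof -
  have ne: "T b \<noteq> {} \<longleftrightarrow> b \<in> diagram l" for b
    using svt_nonempty_iff[OF T] by (cases b) (simp add: less_parts_iff)
  have sub: "T b \<subseteq> {1..N}" for b using svt_subset[OF T] by (cases b) simp
  have "semistandard l t" if t: "\<forall>b\<in>diagram l. t b \<in> T b" for t
    unfolding semistandard_def
  proof (intro conjI allI impI ballI)
    show "1 \<le> t b" if "b \<in> diagram l" for b
      using t sub[of b] that by auto
    show "t (i, j) \<le> t (i, k)" if "(i, j) \<in> diagram l \<and> (i, k) \<in> diagram l \<and> j < k" for i j k
      using svt_row[OF T, of j k "t (i, j)" i "t (i, k)"] that t by blast
    show "t (i, j) < t (k, j)" if "(i, j) \<in> diagram l \<and> (k, j) \<in> diagram l \<and> i < k" for i j k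
      using svt_column[OF T, of i k "t (i, j)" j "t (k, j)"] that t by blast
  qed
  moreover have "finite (T b)" for b
    using sub[of b] by (rule finite_subset) simp
  moreover have "T b \<subseteq> {1..}" for b
    using sub[of b] by auto
  ultimately show ?thesis
    unfolding set_valued_tableaux_def using ne by blast
qed

text \<open>Entries of two different boxes always occur together in some selection: change an
  arbitrary selection \<open>r\<close> in these two boxes. Thus the condition on all selections
  yields the comparisons of pairs.\<close>

lemma set_valued_imp_svt:
  assumes T: "T \<in> set_valued_tableaux l" and N: "\<And>b. T b \<subseteq> {..N}"
  shows "T \<in> svt N (parts l)"
proof -
  have ne: "T b \<noteq> {} \<longleftrightarrow> b \<in> diagram l" for b
    using T unfolding set_valued_tableaux_def by blast
  have pos: "T b \<subseteq> {1..}" for b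
    using T ne[of b] unfolding set_valued_tableaux_def by (cases "b \<in> diagram l") blast+
  define r where "r = (\<lambda>b. SOME s. s \<in> T b)"
  have r: "r b \<in> T b" if "b \<in> diagram l" for b
    using that ne[of b] unfolding r_def by (simp add: some_in_eq)
  have ss: "semistandard l (r(b := s, c := t))" if "s \<in> T b" "t \<in> T c" for b c s t
  proof -
    have "\<forall>d\<in>diagram l. (r(b := s, c := t)) d \<in> T d" using r that by simp
    then show ?thesis using T unfolding set_valued_tableaux_def by blast
  qed
  show ?thesis
  proof (rule svtI)
    show "T (i, j) \<noteq> {} \<longleftrightarrow> j < parts l i" for i j by (simp only: ne less_parts_iff)
    show "T (i, j) \<subseteq> {1..N}" for i j using pos[of "(i, j)"] N[of "(i, j)"] by auto
    show "s \<le> t" if "j < k" "s \<in> T (i, j)" "t \<in> T (i, k)" for i j k s t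
    proof -
      have "(i, j) \<in> diagram l" "(i, k) \<in> diagram l" using that ne by blast+
      with ss[OF that(2,3)] \<open>j < k\<close> have
        "(r((i, j) := s, (i, k) := t)) (i, j) \<le> (r((i, j) := s, (i, k) := t)) (i, k)"
        unfolding semistandard_def by blast
      with \<open>j < k\<close> show ?thesis by simp
    qed
    show "s < t" if "i < k" "s \<in> T (i, j)" "t \<in> T (k, j)" for i j k s t
    proof -
      have "(i, j) \<in> diagram l" "(k, j) \<in> diagram l" using that ne by blast+
      with ss[OF that(2,3)] \<open>i < k\<close> have
        "(r((i, j) := s, (k, j) := t)) (i, j) < (r((i, j) := s, (k, j) := t)) (k, j)"
        unfolding semistandard_def by blast
      with \<open>i < k\<close> show ?thesis by simp
    qed
  qed
qed

definition tableau_content :: "(nat \<times> nat) set \<Rightarrow> (nat \<times> nat \<Rightarrow> nat set) \<Rightarrow> (nat \<Rightarrow>\<^sub>0 nat)" where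
  "tableau_content D T = (\<Sum>b\<in>D. \<Sum>i\<in>T b. Poly_Mapping.single i 1)"

lemma lookup_sum_pm: "Poly_Mapping.lookup (\<Sum>a\<in>A. f a) i = (\<Sum>a\<in>A. Poly_Mapping.lookup (f a) i)"
  by (induction A rule: infinite_finite_induct) (auto simp: lookup_add)

lemma lookup_content:
  assumes "finite D" "\<And>b. b \<in> D \<Longrightarrow> finite (T b)"
  shows "Poly_Mapping.lookup (tableau_content D T) i = card {b \<in> D. i \<in> T b}"
proof -
  have "Poly_Mapping.lookup (tableau_content D T) i = (\<Sum>b\<in>D. if i \<in> T b then 1 else 0)"
    unfolding tableau_content_def lookup_sum_pm
    by (intro sum.cong refl) (use assms in \<open>simp add: lookup_single when_def eq_commute\<close>)
  also have "\<dots> = card {b \<in> D. i \<in> T b}"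
    using assms(1) by (simp add: sum.If_cases Int_def)
  finally show ?thesis .
qed

lemma prod_X_eq_Mon_content: "(\<Prod>b\<in>D. \<Prod>i\<in>T b. X i) = Mon (tableau_content D T)"
  by (simp add: X_def prod_Mon tableau_content_def)

context
  fixes N :: nat and l :: "nat list"
begin

lemma finite_svt_parts: "finite (svt N (parts l))"
  by (rule finite_svt) (simp add: boxes_parts finite_diagram)

lemma lookup_content_svt:
  assumes T: "T \<in> svt N (parts l)"
  shows "Poly_Mapping.lookup (tableau_content (diagram l) T) i = card {b \<in> diagram l. i \<in> T b}"
proof (rule lookup_content[OF finite_diagram])
  show "finite (T b)" for b
    using finite_subset[OF svt_subset[OF T, of "fst b" "snd b"]] by simp
qed

lemma content_eq_iff:
  assumes T: "T \<in> svt N (parts l)"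
  shows "m = tableau_content (diagram l) T \<longleftrightarrow> (\<forall>i. card {b \<in> diagram l. i \<in> T b} = Poly_Mapping.lookup m i)"
  using lookup_content_svt[OF T] by (metis poly_mapping_eqI)

lemma keys_content_svt:
  assumes T: "T \<in> svt N (parts l)"
  shows "Poly_Mapping.keys (tableau_content (diagram l) T) \<subseteq> {..N}"
proof
  fix i assume "i \<in> Poly_Mapping.keys (tableau_content (diagram l) T)"
  then have "card {b \<in> diagram l. i \<in> T b} \<noteq> 0"
    by (simp only: lookup_content_svt[OF T] in_keys_iff not_False_eq_True)
  then have "{b \<in> diagram l. i \<in> T b} \<noteq> {}" by (metis card.empty)
  then obtain a b where "i \<in> T (a, b)" by auto
  then show "i \<in> {..N}" using svt_subset[OF T, of a b] by auto
qed

text \<open>Every entry occurs in the monomial with positive exponent and is therefore at most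
  \<open>N\<close>, so the bound on the entries loses no tableau that contributes to
  \<open>m\<close>.\<close>

lemma set_valued_with_content:
  assumes keys: "Poly_Mapping.keys m \<subseteq> {..N}" and T: "T \<in> set_valued_tableaux l"
    and m: "\<forall>i. card {b \<in> diagram l. i \<in> T b} = Poly_Mapping.lookup m i"
  shows "T \<in> svt N (parts l)"
proof (rule set_valued_imp_svt[OF T])
  fix b
  show "T b \<subseteq> {..N}"
  proof
    fix i assume i: "i \<in> T b"
    then have "b \<in> diagram l" using T unfolding set_valued_tableaux_def by blast
    with i have "card {b \<in> diagram l. i \<in> T b} \<noteq> 0"
      using finite_diagram[of l] by (cases b) auto
    then have "i \<in> Poly_Mapping.keys m" using m by (simp add: in_keys_iff)
    with keys show "i \<in> {..N}" by blast
  qed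
qed

lemma trunc_Gt: "trunc N (Gt l) = tableau_sum 1 N (parts l)"
proof (rule pseries_eqI)
  fix m
  have "pcoeff (tableau_sum 1 N (parts l)) m = (\<Sum>T\<in>svt N (parts l). if m = tableau_content (diagram l) T then 1 else 0)"
    by (simp add: tableau_sum_def box_weight_def boxes_parts prod_X_eq_Mon_content pcoeff_Mon)
  also have "\<dots> = real (card {T \<in> svt N (parts l). m = tableau_content (diagram l) T})"
    using finite_svt_parts by (simp add: sum.If_cases Int_def)
  also have "\<dots> = pcoeff (trunc N (Gt l)) m"
  proof (cases "Poly_Mapping.keys m \<subseteq> {..N}")
    case True
    have "{T \<in> svt N (parts l). m = tableau_content (diagram l) T} = {T \<in> set_valued_tableaux l.
        \<forall>i. card {b \<in> diagram l. i \<in> T b} = Poly_Mapping.lookup m i}"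
      using svt_imp_set_valued set_valued_with_content[OF True] content_eq_iff by blast
    with True show ?thesis by (simp add: pcoeff_trunc Gt_def)
  next
    case False
    then have "{T \<in> svt N (parts l). m = tableau_content (diagram l) T} = {}"
      using keys_content_svt by blast
    with False show ?thesis by (simp only: pcoeff_trunc) simp
  qed
  finally show "pcoeff (trunc N (Gt l)) m = pcoeff (tableau_sum 1 N (parts l)) m" ..
qed

lemma box_weight_zero_prod:
  assumes T: "T \<in> svt N (parts l)"
  shows "(\<Prod>b\<in>diagram l. box_weight 0 (T b)) =
    (if \<forall>b\<in>diagram l. card (T b) = 1 then Mon (tableau_content (diagram l) T) else 0)"
proof (cases "\<forall>b\<in>diagram l. card (T b) = 1")
  case True
  then show ?thesis
    by (simp add: prod_X_eq_Mon_content[symmetric] box_weight_def)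
next
  case False
  then obtain i j where b: "(i, j) \<in> diagram l" "card (T (i, j)) \<noteq> 1" by auto
  then have "T (i, j) \<noteq> {}" "finite (T (i, j))"
    using svt_nonempty_iff[OF T, of i j] svt_subset[OF T, of i j]
    by (auto simp: less_parts_iff finite_subset)
  then have "card (T (i, j)) \<noteq> 0" by simp
  with b(2) have "card (T (i, j)) - 1 \<noteq> 0" by simp
  then have "box_weight 0 (T (i, j)) = 0" by (simp only: box_weight_def zero_power mult_zero_left)
  then have "(\<Prod>b\<in>diagram l. box_weight 0 (T b)) = 0"
    using b(1) finite_diagram by (intro prod_zero) auto
  then show ?thesis by (simp only: False if_False)
qed

text \<open>For \<open>\<beta> = 0\<close> only tableaux with one entry in each box survive; turning
  entries into singletons identifies them with semistandard tableaux.\<close>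

lemma trunc_schur: "trunc N (schur l) = tableau_sum 0 N (parts l)"
proof (rule pseries_eqI)
  fix m
  let ?B = "{T \<in> svt N (parts l). (\<forall>b\<in>diagram l. card (T b) = 1) \<and> m = tableau_content (diagram l) T}"
  have "pcoeff (tableau_sum 0 N (parts l)) m = (\<Sum>T\<in>svt N (parts l).
      if (\<forall>b\<in>diagram l. card (T b) = 1) \<and> m = tableau_content (diagram l) T then 1 else 0)"
    unfolding tableau_sum_def boxes_parts pcoeff_sum
    by (intro sum.cong refl) (simp add: box_weight_zero_prod pcoeff_Mon)
  also have "\<dots> = real (card ?B)"
    using finite_svt_parts by (simp add: sum.If_cases Int_def)
  also have "\<dots> = pcoeff (trunc N (schur l)) m"
  proof (cases "Poly_Mapping.keys m \<subseteq> {..N}")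
    case True
    let ?A = "{t \<in> ssyt l. \<forall>i. card {b \<in> diagram l. t b = i} = Poly_Mapping.lookup m i}"
    define F where "F = (\<lambda>t b. if b \<in> diagram l then {t b :: nat} else {})"
    have F_count: "{b \<in> diagram l. i \<in> F t b} = {b \<in> diagram l. t b = i}" for t i
      by (auto simp: F_def)
    \<comment> \<open>Outside the diagram the two dummy values, \<open>0\<close> and the empty set,
      have to be exchanged.\<close>
    have "bij_betw F ?A ?B"
    proof (rule bij_betwI[where g = "\<lambda>T b. if b \<in> diagram l then the_elem (T b) else 0"])
      show "F \<in> ?A \<rightarrow> ?B"
      proof
        fix t assume t: "t \<in> ?A"
        then have ss: "semistandard l t" by (simp add: ssyt_def)
        have "F t \<in> set_valued_tableaux l"
          unfolding set_valued_tableaux_def mem_Collect_eq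
        proof (intro conjI allI impI ballI)
          fix t' assume "\<forall>b\<in>diagram l. t' b \<in> F t b"
          then have "t' b = t b" if "b \<in> diagram l" for b using that by (simp add: F_def)
          with ss show "semistandard l t'" unfolding semistandard_def by simp
        qed (use ss in \<open>auto simp: F_def semistandard_def Suc_le_eq\<close>)
        moreover have "\<forall>i. card {b \<in> diagram l. i \<in> F t b} = Poly_Mapping.lookup m i"
          using t by (simp add: F_count)
        ultimately have "F t \<in> svt N (parts l)" "m = tableau_content (diagram l) (F t)"
          using set_valued_with_content[OF True] content_eq_iff by blast+
        then show "F t \<in> ?B" by (simp add: F_def)
      qed
      show "(\<lambda>T b. if b \<in> diagram l then the_elem (T b) else 0) \<in> ?B \<rightarrow> ?A"
      proof
        fix T assume T: "T \<in> ?B"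
        define t where "t = (\<lambda>b. if b \<in> diagram l then the_elem (T b) else 0)"
        have svt: "T \<in> svt N (parts l)" and m: "m = tableau_content (diagram l) T" using T by auto
        have single: "T b = {t b}" if "b \<in> diagram l" for b
          using T that by (auto simp: card_1_singleton_iff t_def)
        have "\<forall>b\<in>diagram l. t b \<in> T b" using single by blast
        then have "semistandard l t"
          using svt_imp_set_valued[OF svt] unfolding set_valued_tableaux_def by blast
        moreover have "t b = 0" if "b \<notin> diagram l" for b using that by (simp add: t_def)
        moreover have "{b \<in> diagram l. t b = i} = {b \<in> diagram l. i \<in> T b}" for i
          by (intro Collect_cong conj_cong refl) (simp add: single eq_commute)
        ultimately have "t \<in> ?A"
          using m[unfolded content_eq_iff[OF svt]] by (simp only: ssyt_def mem_Collect_eq) blast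
        then show "(\<lambda>b. if b \<in> diagram l then the_elem (T b) else 0) \<in> ?A"
          by (simp only: t_def)
      qed
      show "(\<lambda>b. if b \<in> diagram l then the_elem (F t b) else 0) = t" if "t \<in> ?A" for t
        using that by (auto simp: F_def ssyt_def)
      show "F (\<lambda>b. if b \<in> diagram l then the_elem (T b) else 0) = T" if "T \<in> ?B" for T
      proof (rule ext, goal_cases)
        case (1 b)
        show ?case
        proof (cases "b \<in> diagram l")
          case True
          then show ?thesis using that by (auto simp: F_def card_1_singleton_iff)
        next
          case False
          moreover have "T b = {}"
            using False svt_nonempty_iff[of T N "parts l" "fst b" "snd b"] that by (simp add: less_parts_iff)
          ultimately show ?thesis by (simp add: F_def)
        qed
      qed
    qed
    with True show ?thesis by (simp add: pcoeff_trunc schur_def bij_betw_same_card)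
  next
    case False
    then have "?B = {}" using keys_content_svt by blast
    with False show ?thesis by (simp only: pcoeff_trunc) simp
  qed
  finally show "pcoeff (trunc N (schur l)) m = pcoeff (tableau_sum 0 N (parts l)) m" ..
qed

end

section \<open>Multiplication by powers of \<open>1 + Gt [1]\<close> and by columns\<close>

text \<open>Cutting at the first zero inverts \<open>parts\<close> on weakly decreasing functions
  that are eventually zero.\<close>

definition part_list :: "(nat \<Rightarrow> nat) \<Rightarrow> nat list" where
  "part_list \<mu> = map \<mu> [0..<LEAST n. \<mu> n = 0]"

lemma parts_eq_0: "length l \<le> i \<Longrightarrow> parts l i = 0"
  by (simp add: parts_def)

lemma antimono_parts:
  assumes "is_partition l"
  shows "antimono (parts l)"
  unfolding antimono_iff_le_Suc
  using assms by (auto simp: parts_def is_partition_def sorted_wrt_iff_nth_less)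

lemma part_list_parts:
  assumes "is_partition l"
  shows "part_list (parts l) = l"
proof -
  have "(LEAST n. parts l n = 0) = length l"
  proof (rule Least_equality)
    show "length l \<le> n" if "parts l n = 0" for n
    proof (rule ccontr)
      assume "\<not> length l \<le> n"
      then have "n < length l" "l ! n = 0" using that by (auto simp: parts_def)
      then have "0 \<in> set l" by (metis nth_mem)
      then show False using assms by (simp add: is_partition_def)
    qed
  qed (simp add: parts_def)
  then show ?thesis by (auto simp: part_list_def parts_def intro: nth_equalityI)
qed

context
  fixes \<mu> :: "nat \<Rightarrow> nat" and N :: nat
  assumes anti: "antimono \<mu>" and bound: "\<And>i. i \<ge> N \<Longrightarrow> \<mu> i = 0"
begin

lemma is_partition_part_list: "is_partition (part_list \<mu>)"
proof -
  have "\<mu> j \<noteq> 0" if "j < (LEAST n. \<mu> n = 0)" for j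
    using not_less_Least[OF that] .
  then have "0 \<notin> set (part_list \<mu>)"
    unfolding part_list_def set_map set_upt by (metis (no_types, lifting) atLeastLessThan_iff imageE)
  then show ?thesis
    using anti by (simp add: is_partition_def part_list_def sorted_wrt_iff_nth_less antimonoD)
qed

lemma parts_part_list: "parts (part_list \<mu>) = \<mu>"
proof
  fix i
  let ?L = "LEAST n. \<mu> n = 0"
  have "\<mu> ?L = 0" by (rule LeastI[of _ N]) (simp add: bound)
  then have "\<mu> i = 0" if "?L \<le> i" using antimonoD[OF anti that] by simp
  then show "parts (part_list \<mu>) i = \<mu> i"
    by (auto simp: parts_def part_list_def)
qed

end

definition add_strip :: "(nat \<Rightarrow> nat) \<Rightarrow> nat set \<Rightarrow> nat \<Rightarrow> nat" where
  "add_strip \<mu> S i = \<mu> i + (if i \<in> S then 1 else 0)"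

text \<open>The numerators of Schur and Grothendieck polynomials differ only in the exponents of
  \<open>1 + y\<close>; leaving these free gives room for the intermediate stages.\<close>

definition mixed_alternant :: "(nat \<Rightarrow> nat) \<Rightarrow> nat \<Rightarrow> (nat \<Rightarrow> nat) \<Rightarrow> pseries" where
  "mixed_alternant e N \<mu> = alternant (\<lambda>i. X (Suc i)) N (\<lambda>j y. y ^ (\<mu> j + (N - Suc j)) * (1 + y) ^ e j)"

lemma bialternant_0_eq: "bialternant 0 N \<mu> = mixed_alternant (\<lambda>_. 0) N \<mu>"
  and bialternant_1_eq: "bialternant 1 N \<mu> = mixed_alternant (\<lambda>j. j) N \<mu>"
  by (simp_all add: bialternant_def mixed_alternant_def)

lemma power_add_strip: "(y :: pseries) ^ (add_strip \<mu> S j + q) = (if j \<in> S then y else 1) * y ^ (\<mu> j + q)"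
  by (simp add: add_strip_def)

lemma add_strip_columns:
  "alternant (\<lambda>i. X (Suc i)) N
     (\<lambda>j y. (if j \<in> S then y else 1) * (y ^ (\<mu> j + (N - Suc j)) * (1 + y) ^ e j)) =
   mixed_alternant e N (add_strip \<mu> S)"
  unfolding mixed_alternant_def by (rule alternant_cong) (simp only: power_add_strip mult.assoc)

text \<open>If monotonicity fails at \<open>i\<close>, then rows \<open>i\<close> and
  \<open>Suc i\<close> of \<mu> have equal length and only the lower one receives a box. The shift
  between \<open>N - Suc i\<close> and \<open>N - Suc (Suc i)\<close> compensates for this box, so
  the two columns coincide.\<close>

lemma mixed_alternant_add_strip_eq_0:
  assumes \<mu>: "antimono \<mu>" and S: "S \<subseteq> {..<N}" and e: "\<And>i. Suc i \<in> S \<Longrightarrow> e i = e (Suc i)"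
    and not: "\<not> antimono (add_strip \<mu> S)"
  shows "mixed_alternant e N (add_strip \<mu> S) = 0"
proof -
  obtain i where i: "add_strip \<mu> S i < add_strip \<mu> S (Suc i)"
    using not by (auto simp: antimono_iff_le_Suc not_le)
  have "\<mu> (Suc i) \<le> \<mu> i" using \<mu> by (simp add: antimono_iff_le_Suc)
  with i have *: "i \<notin> S" "Suc i \<in> S" "\<mu> i = \<mu> (Suc i)"
    by (auto simp: add_strip_def split: if_splits)
  then have "Suc i < N" using S by auto
  then have "N - Suc i = Suc (N - Suc (Suc i))" by simp
  then show ?thesis
    unfolding mixed_alternant_def using * e \<open>Suc i < N\<close>
    by (intro alternant_identical_columns[of i _ "Suc i"]) (auto simp: add_strip_def)
qed

text \<open>Vertical strips that can be added to \<mu> within the first \<open>p\<close> rows, given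
  by the rows that receive a box.\<close>

definition strips :: "(nat \<Rightarrow> nat) \<Rightarrow> nat \<Rightarrow> nat set set" where
  "strips \<mu> p = {S. S \<subseteq> {..<p} \<and> antimono (add_strip \<mu> S)}"

lemma finite_strips: "finite (strips \<mu> p)"
  by (rule finite_subset[of _ "Pow {..<p}"]) (auto simp: strips_def)

text \<open>The sum runs over all ways to add vertical strips successively within the first
  \<open>p\<close>, \<open>p - 1\<close>, ..., \<open>1\<close> rows. No signs occur, which is what
  positivity will rest on.\<close>

primrec Gt_expansion :: "nat \<Rightarrow> (nat \<Rightarrow> nat) \<Rightarrow> pseries" where
  "Gt_expansion 0 \<mu> = Gt (part_list \<mu>)"
| "Gt_expansion (Suc p) \<mu> = (\<Sum>S\<in>strips \<mu> (Suc p). Gt_expansion p (add_strip \<mu> S))"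

text \<open>The functions \<open>max (Suc p)\<close> and \<open>max p\<close> differ, by one, only
  in the columns up to \<open>p\<close>, so one factor \<open>1 + y\<close> is expanded in each of
  them. Since \<open>max p\<close> is constant on these columns, the strips that do not give a
  partition cancel.\<close>

lemma mixed_alternant_Suc:
  assumes "antimono \<mu>" "Suc p \<le> N"
  shows "mixed_alternant (max (Suc p)) N \<mu> =
    (\<Sum>S\<in>strips \<mu> (Suc p). mixed_alternant (max p) N (add_strip \<mu> S))"
proof -
  have "mixed_alternant (max (Suc p)) N \<mu> = alternant (\<lambda>i. X (Suc i)) N
      (\<lambda>j y. (if j \<in> {..<Suc p} then 1 + y else 1) * (y ^ (\<mu> j + (N - Suc j)) * (1 + y) ^ max p j))"
    unfolding mixed_alternant_def by (rule alternant_cong) (auto simp: max_absorb1 max_absorb2 not_less mult_ac)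
  also have "\<dots> = (\<Sum>S\<in>Pow {..<Suc p}. mixed_alternant (max p) N (add_strip \<mu> S))"
    using assms(2) by (subst alternant_add_variable) (auto simp only: add_strip_columns lessThan_subset_iff)
  also have "\<dots> = (\<Sum>S\<in>strips \<mu> (Suc p). mixed_alternant (max p) N (add_strip \<mu> S))"
  proof (rule sum.mono_neutral_right)
    show "\<forall>S\<in>Pow {..<Suc p} - strips \<mu> (Suc p). mixed_alternant (max p) N (add_strip \<mu> S) = 0"
    proof
      fix S assume "S \<in> Pow {..<Suc p} - strips \<mu> (Suc p)"
      then show "mixed_alternant (max p) N (add_strip \<mu> S) = 0"
        using assms by (intro mixed_alternant_add_strip_eq_0) (auto simp: strips_def max_def)
    qed
  qed (auto simp: strips_def)
  finally show ?thesis .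
qed

lemma mixed_alternant_Gt_expansion:
  assumes "antimono \<mu>" "\<And>i. i \<ge> N \<Longrightarrow> \<mu> i = 0" "p \<le> N"
  shows "mixed_alternant (max p) N \<mu> = vandermonde N * trunc N (Gt_expansion p \<mu>)"
  using assms
proof (induction p arbitrary: \<mu>)
  case 0
  have "mixed_alternant (max 0) N \<mu> = bialternant 1 N \<mu>"
    unfolding bialternant_1_eq by (rule arg_cong[where f = "\<lambda>e. mixed_alternant e N \<mu>"]) auto
  also have "\<dots> = vandermonde N * tableau_sum 1 N \<mu>"
    using 0 by (intro bialternant_formula) auto
  finally show ?case
    by (simp only: Gt_expansion.simps trunc_Gt parts_part_list[OF 0(1,2)])
next
  case (Suc p)
  have "mixed_alternant (max p) N (add_strip \<mu> S) = vandermonde N * trunc N (Gt_expansion p (add_strip \<mu> S))"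
    if "S \<in> strips \<mu> (Suc p)" for S
  proof (rule Suc.IH)
    show "add_strip \<mu> S i = 0" if "i \<ge> N" for i
      using that \<open>S \<in> strips \<mu> (Suc p)\<close> Suc.prems(2)[of i] Suc.prems(3)
      by (auto simp: add_strip_def strips_def)
  qed (use that Suc.prems in \<open>auto simp: strips_def\<close>)
  then show ?case
    using Suc.prems by (simp add: mixed_alternant_Suc sum_distrib_left)
qed

text \<open>For \<open>c \<ge> k\<close> the column \<open>c\<close> is \<open>y\<^bsup>N - 1 - c\<^esup> * (1 + y)\<^bsup>k\<^esup>\<close>, so the binomial expansion of
  \<open>(1 + y)\<^bsup>j - k\<^esup>\<close> writes the new column \<open>j\<close> as the old one plus multiples of earlier ones.\<close>

lemma mixed_alternant_const:
  assumes "\<And>i. i \<ge> k \<Longrightarrow> \<mu> i = 0"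
  shows "mixed_alternant (\<lambda>_. k) N \<mu> = mixed_alternant (max k) N \<mu>"
proof -
  define u :: "nat \<Rightarrow> nat \<Rightarrow> pseries" where
    "u = (\<lambda>c j. if c = j then 1 else if k \<le> c \<and> c < j then of_nat ((j - k) choose (j - c)) else 0)"
  let ?x = "\<lambda>i. X (Suc i)"
  have "alternant ?x N (\<lambda>j y. y ^ (\<mu> j + (N - Suc j)) * (1 + y) ^ max k j) =
      (\<Prod>j<N. u j j) * alternant ?x N (\<lambda>j y. y ^ (\<mu> j + (N - Suc j)) * (1 + y) ^ k)"
  proof (rule alternant_column_operation[where u = u])
    show "(\<forall>c<N. \<forall>j<c. u c j = 0) \<or> (\<forall>j<N. \<forall>c<j. u c j = 0)" by (auto simp: u_def)
  next
    fix i j assume j: "j < N"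
    let ?y = "?x i"
    let ?f = "\<lambda>c. ?y ^ (\<mu> c + (N - Suc c)) * (1 + ?y) ^ k * u c j"
    show "?y ^ (\<mu> j + (N - Suc j)) * (1 + ?y) ^ max k j = (\<Sum>c<N. ?f c)"
    proof (cases "j \<le> k")
      case True
      have "(\<Sum>c<N. ?f c) = (\<Sum>c\<in>{j}. ?f c)"
        by (rule sum.mono_neutral_right) (use j True in \<open>auto simp: u_def\<close>)
      then show ?thesis using True by (simp add: u_def max_def)
    next
      case False
      have "(\<Sum>c<N. ?f c) = (\<Sum>c\<in>{k..j}. ?f c)"
        by (rule sum.mono_neutral_right) (use j False in \<open>auto simp: u_def\<close>)
      also have "\<dots> = (\<Sum>d\<le>j - k. ?y ^ (N - Suc j) * (1 + ?y) ^ k *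
          (of_nat ((j - k) choose d) * ?y ^ d * 1 ^ (j - k - d)))"
      proof (rule sum.reindex_bij_witness[where i = "\<lambda>d. j - d" and j = "\<lambda>c. j - c"])
        fix c assume c: "c \<in> {k..j}"
        then have "\<mu> c = 0" and N: "N - Suc c = (N - Suc j) + (j - c)" using assms j by auto
        moreover have "u c j = of_nat ((j - k) choose (j - c))" using c by (auto simp: u_def)
        ultimately show "?y ^ (N - Suc j) * (1 + ?y) ^ k *
          (of_nat ((j - k) choose (j - c)) * ?y ^ (j - c) * 1 ^ (j - k - (j - c))) = ?f c"
          by (simp only: N) (simp add: power_add mult_ac)
      qed (use False in auto)
      also have "\<dots> = ?y ^ (N - Suc j) * (1 + ?y) ^ k * (?y + 1) ^ (j - k)"
        unfolding binomial_ring[of ?y 1 "j - k"] sum_distrib_left ..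
      also have "\<dots> = ?y ^ (\<mu> j + (N - Suc j)) * (1 + ?y) ^ max k j"
        using False assms[of j] by (simp add: max_def add.commute[of _ 1] mult.assoc power_add[symmetric])
      finally show ?thesis ..
    qed
  qed
  then show ?thesis by (simp add: mixed_alternant_def u_def)
qed

lemma mixed_alternant_const_eq:
  "mixed_alternant (\<lambda>_. k) N \<mu> = (\<Prod>i<N. 1 + X (Suc i)) ^ k * mixed_alternant (\<lambda>_. 0) N \<mu>"
proof -
  have "mixed_alternant (\<lambda>_. k) N \<mu> = alternant (\<lambda>i. X (Suc i)) N
      (\<lambda>j y. (1 + y) ^ k * (y ^ (\<mu> j + (N - Suc j)) * (1 + y) ^ 0))"
    unfolding mixed_alternant_def by (rule alternant_cong) (simp add: mult_ac)
  then show ?thesis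
    unfolding alternant_scale_rows by (simp add: mixed_alternant_def prod_power_distrib)
qed

lemma mixed_alternant_schur:
  assumes "is_partition l" "length l \<le> N"
  shows "mixed_alternant (\<lambda>_. 0) N (parts l) = vandermonde N * trunc N (schur l)"
  unfolding bialternant_0_eq[symmetric] trunc_schur
  by (rule bialternant_formula) (use assms antimono_parts[OF assms(1)] in \<open>simp_all add: parts_eq_0\<close>)

text \<open>The power turns the Schur numerator into the one with constant exponents
  \<open>k\<close>; rows from \<open>k\<close> on are empty, so column operations make the exponents
  \<open>max k j\<close>, and the vertical strip expansion applies.\<close>

lemma trunc_power_schur:
  assumes "is_partition l" "length l \<le> k" "k \<le> N"
  shows "(\<Prod>i<N. 1 + X (Suc i)) ^ k * trunc N (schur l) = trunc N (Gt_expansion k (parts l))"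
proof (rule vandermonde_cancel)
  have "vandermonde N * ((\<Prod>i<N. 1 + X (Suc i)) ^ k * trunc N (schur l)) =
      mixed_alternant (\<lambda>_. k) N (parts l)"
    using assms by (simp add: mixed_alternant_const_eq[of k] mixed_alternant_schur mult_ac)
  also have "\<dots> = mixed_alternant (max k) N (parts l)"
    using assms by (intro mixed_alternant_const) (simp add: parts_eq_0)
  also have "\<dots> = vandermonde N * trunc N (Gt_expansion k (parts l))"
    using assms by (intro mixed_alternant_Gt_expansion antimono_parts) (auto simp: parts_eq_0)
  finally show "vandermonde N * ((\<Prod>i<N. 1 + X (Suc i)) ^ k * trunc N (schur l)) =
    vandermonde N * trunc N (Gt_expansion k (parts l))" .
qed

lemma is_partition_Nil [simp]: "is_partition []"
  and is_partition_single [simp]: "is_partition [n] \<longleftrightarrow> n > 0"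
  by (auto simp: is_partition_def)

lemma parts_0 [simp]: "parts [0] = parts []"
  by (auto simp: parts_def)

lemma schur_Nil: "schur [] = 1"
  by (rule trunc_eqI[of 0]) (simp add: trunc_schur tableau_sum_zero parts_def)

lemma Gt_Nil: "Gt [] = 1"
  by (rule trunc_eqI[of 0]) (simp add: trunc_Gt tableau_sum_zero parts_def)

text \<open>Only row 0 can receive a box. The form \<open>part_list (parts [n])\<close> also covers
  \<open>n = 0\<close>, where it is the empty list.\<close>

lemma Gt_expansion_single:
  "Gt_expansion 1 (parts [n]) = Gt (part_list (parts [n])) + Gt [Suc n]"
proof -
  have eq: "add_strip (parts [n]) {} = parts [n]" "add_strip (parts [n]) {0} = parts [Suc n]"
    by (auto simp: add_strip_def parts_def)
  have "antimono (parts [n])"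
    using antimono_parts[of "[n]"] antimono_parts[of "[]"] by (cases n) auto
  then have "strips (parts [n]) 1 = {{}, {0}}"
    using antimono_parts[of "[Suc n]"] eq by (auto simp: strips_def)
  then show ?thesis
    by (simp add: eq part_list_parts)
qed

text \<open>This is \<open>trunc_power_schur\<close> for the empty shape and \<open>k = 1\<close>,
  with the expansion computed for \<open>n = 0\<close>.\<close>

lemma trunc_one_plus_Gt:
  assumes "N \<ge> 1"
  shows "trunc N (1 + Gt [1]) = (\<Prod>i<N. 1 + X (Suc i))"
proof -
  have "Gt_expansion 1 (parts []) = 1 + Gt [1]"
    using Gt_expansion_single[of 0] by (simp only: parts_0 part_list_parts is_partition_Nil Gt_Nil One_nat_def)
  then show ?thesis
    using trunc_power_schur[of "[]" 1 N] assms by (simp only: schur_Nil trunc_one) simp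
qed

lemma power_mult_schur:
  assumes "is_partition l" "length l \<le> k"
  shows "(1 + Gt [1]) ^ k * schur l = Gt_expansion k (parts l)"
proof (rule trunc_eqI[of "max 1 k"])
  fix N assume "N \<ge> max 1 k"
  then show "trunc N ((1 + Gt [1]) ^ k * schur l) = trunc N (Gt_expansion k (parts l))"
    using trunc_power_schur[OF assms, of N] trunc_one_plus_Gt[of N]
    by (simp only: trunc_mult trunc_power max.bounded_iff)
qed

section \<open>Pieri rule for columns\<close>

definition esym :: "nat \<Rightarrow> nat \<Rightarrow> pseries" where
  "esym N k = (\<Sum>S | S \<subseteq> {..<N} \<and> card S = k. \<Prod>i\<in>S. X (Suc i))"

text \<open>Multiplying the numerator by \<open>esym N k\<close> adds boxes in \<open>k\<close>
  different rows; the choices that do not give a partition produce equal columns. What is left is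
  the Pieri rule for vertical strips.\<close>

lemma esym_mult_schur:
  assumes l: "is_partition l" "length l \<le> N"
  shows "esym N k * trunc N (schur l) =
    (\<Sum>S | S \<in> strips (parts l) N \<and> card S = k. trunc N (schur (part_list (add_strip (parts l) S))))"
proof (rule vandermonde_cancel)
  let ?\<mu> = "parts l"
  have fin: "finite {S. S \<subseteq> {..<N} \<and> card S = k}"
    by (rule finite_subset[of _ "Pow {..<N}"]) auto
  have "vandermonde N * (esym N k * trunc N (schur l)) = esym N k * mixed_alternant (\<lambda>_. 0) N ?\<mu>"
    using l by (simp add: mixed_alternant_schur mult_ac)
  also have "\<dots> = (\<Sum>S | S \<subseteq> {..<N} \<and> card S = k. mixed_alternant (\<lambda>_. 0) N (add_strip ?\<mu> S))"
    unfolding esym_def mixed_alternant_def[of _ N ?\<mu>] alternant_esym add_strip_columns ..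
  also have "\<dots> = (\<Sum>S | S \<in> strips ?\<mu> N \<and> card S = k. mixed_alternant (\<lambda>_. 0) N (add_strip ?\<mu> S))"
    by (rule sum.mono_neutral_right[OF fin])
      (auto simp: strips_def intro!: mixed_alternant_add_strip_eq_0 antimono_parts l)
  also have "\<dots> = (\<Sum>S | S \<in> strips ?\<mu> N \<and> card S = k.
      vandermonde N * trunc N (schur (part_list (add_strip ?\<mu> S))))"
  proof (rule sum.cong[OF refl])
    fix S assume "S \<in> {S. S \<in> strips ?\<mu> N \<and> card S = k}"
    then have anti: "antimono (add_strip ?\<mu> S)" and "S \<subseteq> {..<N}" by (auto simp: strips_def)
    then have bound: "add_strip ?\<mu> S i = 0" if "i \<ge> N" for i
      using that l(2) by (auto simp: add_strip_def parts_def)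
    then have "mixed_alternant (\<lambda>_. 0) N (add_strip ?\<mu> S) = vandermonde N * tableau_sum 0 N (add_strip ?\<mu> S)"
      unfolding bialternant_0_eq[symmetric] using anti by (intro bialternant_formula) auto
    then show "mixed_alternant (\<lambda>_. 0) N (add_strip ?\<mu> S) =
        vandermonde N * trunc N (schur (part_list (add_strip ?\<mu> S)))"
      by (simp only: trunc_schur parts_part_list[OF anti bound])
  qed
  finally show "vandermonde N * (esym N k * trunc N (schur l)) = vandermonde N *
      (\<Sum>S | S \<in> strips ?\<mu> N \<and> card S = k. trunc N (schur (part_list (add_strip ?\<mu> S))))"
    by (simp add: sum_distrib_left)
qed

text \<open>Below the shape, a strip must fill consecutive rows starting at \<open>length l\<close>,
  so \<open>k\<close> boxes cannot reach row \<open>length l + k\<close>. The index set of the Pieri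
  rule thus does not depend on large \<open>N\<close>, and the rule passes to series.\<close>

lemma strips_card_bound:
  assumes "is_partition l" "length l + k \<le> N"
  shows "{S. S \<in> strips (parts l) N \<and> card S = k} = {S. S \<in> strips (parts l) (length l + k) \<and> card S = k}"
proof -
  have "S \<subseteq> {..<length l + k}" if S: "S \<in> strips (parts l) N" and k: "card S = k" for S
  proof
    fix j assume j: "j \<in> S"
    have fin: "finite S" using S by (auto simp: strips_def finite_subset)
    have "i \<in> S" if i: "i \<in> {length l..j}" for i
    proof -
      have "antimono (add_strip (parts l) S)" using S by (simp add: strips_def)
      from antimonoD[OF this, of i j] i j have "add_strip (parts l) S i \<ge> 1"
        by (simp add: add_strip_def)
      then show ?thesis using i by (simp add: add_strip_def parts_def split: if_splits)
    qed
    then have "{length l..j} \<subseteq> S" by blast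
    then have "card {length l..j} \<le> k" using card_mono[OF fin] k by blast
    then show "j \<in> {..<length l + k}" by simp
  qed
  then show ?thesis using assms(2) by (fastforce simp: strips_def)
qed

text \<open>The Pieri rule for the empty shape: \<open>{..<k}\<close> is the only strip with
  \<open>k\<close> boxes.\<close>

lemma trunc_schur_column:
  assumes "k \<le> N"
  shows "trunc N (schur (replicate k 1)) = esym N k"
proof -
  have eq: "add_strip (parts []) {..<k} = parts (replicate k 1)"
    by (auto simp: add_strip_def parts_def)
  have part: "is_partition (replicate k 1)" by (auto simp: is_partition_def sorted_wrt_iff_nth_less)
  have "{S. S \<in> strips (parts []) N \<and> card S = k} = {S. S \<in> strips (parts []) k \<and> card S = k}"
    using strips_card_bound[of "[]" k N] assms by simp
  also have "\<dots> = {{..<k}}"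
    using card_subset_eq[of "{..<k}"] antimono_parts[OF part] by (auto simp: strips_def eq)
  finally show ?thesis
    using esym_mult_schur[of "[]" N k]
    by (simp only: schur_Nil trunc_one mult_1_right is_partition_Nil list.size le0)
      (simp only: sum.insert[OF finite.emptyI] sum.empty eq part_list_parts[OF part] empty_iff
        not_False_eq_True add_0_right)
qed

lemma column_mult_schur:
  assumes "is_partition l"
  shows "schur (replicate k 1) * schur l =
    (\<Sum>S | S \<in> strips (parts l) (length l + k) \<and> card S = k. schur (part_list (add_strip (parts l) S)))"
proof (rule trunc_eqI[of "length l + k"])
  fix N assume N: "N \<ge> length l + k"
  then show "trunc N (schur (replicate k 1) * schur l) = trunc N (\<Sum>S | S \<in> strips (parts l) (length l + k) \<and> card S = k.
      schur (part_list (add_strip (parts l) S)))"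
    using esym_mult_schur[OF assms, of N k] strips_card_bound[OF assms N] trunc_schur_column[of k N]
    by simp
qed

section \<open>Schur functions span the symmetric functions\<close>

definition mon_degree :: "(nat \<Rightarrow>\<^sub>0 nat) \<Rightarrow> nat" where
  "mon_degree m = (\<Sum>i\<in>Poly_Mapping.keys m. Poly_Mapping.lookup m i)"

lemma mon_degree_add_single: "mon_degree (m + Poly_Mapping.single i 1) = Suc (mon_degree m)"
proof -
  have eq: "mon_degree m' = (\<Sum>j\<in>A. Poly_Mapping.lookup m' j)" if "finite A" "Poly_Mapping.keys m' \<subseteq> A" for m' A
    unfolding mon_degree_def using that by (intro sum.mono_neutral_left) (auto simp: in_keys_iff)
  let ?A = "insert i (Poly_Mapping.keys m)"
  have "mon_degree (m + Poly_Mapping.single i 1) = (\<Sum>j\<in>?A. Poly_Mapping.lookup m j + (if j = i then 1 else 0))"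
    by (subst eq[of ?A]) (auto simp: keys_add_nat lookup_add lookup_single when_def intro!: sum.cong)
  also have "\<dots> = Suc (mon_degree m)"
    by (subst eq[of ?A m]) (auto simp: sum.distrib)
  finally show ?thesis .
qed

lemma mon_degree_eq_0_iff: "mon_degree m = 0 \<longleftrightarrow> m = 0"
  by (auto simp: mon_degree_def in_keys_iff intro!: poly_mapping_eqI)

lemma pcoeff_hsym: "pcoeff (hsym n) m = (if mon_degree m = n \<and> Poly_Mapping.lookup m 0 = 0 then 1 else 0)"
  by (simp add: hsym_def mon_degree_def)

lemma hsym_0: "hsym 0 = 1"
  by (rule pseries_eqI) (auto simp: pcoeff_hsym pcoeff_one mon_degree_eq_0_iff)

lemma trunc_0_hsym: "trunc 0 (hsym n) = (if n = 0 then 1 else 0)"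
proof (cases "n = 0")
  case False
  have "m = 0" if "Poly_Mapping.keys m \<subseteq> {..0}" "Poly_Mapping.lookup m 0 = 0" for m :: "nat \<Rightarrow>\<^sub>0 nat"
  proof -
    have "Poly_Mapping.lookup m i = 0" for i
      using that by (cases "i = 0") (auto simp: in_keys_iff subset_iff)
    then show ?thesis by (intro poly_mapping_eqI) simp
  qed
  then show ?thesis
    using False by (intro pseries_eqI) (auto simp: pcoeff_trunc pcoeff_hsym mon_degree_eq_0_iff[THEN iffD2])
qed (simp add: hsym_0)

text \<open>A monomial of degree \<open>Suc n\<close> either avoids the last variable or is that
  variable times a monomial of degree \<open>n\<close>.\<close>

lemma trunc_Suc_hsym:
  "trunc (Suc N) (hsym (Suc n)) = trunc N (hsym (Suc n)) + X (Suc N) * trunc (Suc N) (hsym n)"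
proof (rule pseries_eqI)
  fix m :: "nat \<Rightarrow>\<^sub>0 nat"
  show "pcoeff (trunc (Suc N) (hsym (Suc n))) m =
    pcoeff (trunc N (hsym (Suc n)) + X (Suc N) * trunc (Suc N) (hsym n)) m"
  proof (cases "Poly_Mapping.lookup m (Suc N) = 0")
    case True
    then have "Poly_Mapping.keys m \<subseteq> {..Suc N} \<longleftrightarrow> Poly_Mapping.keys m \<subseteq> {..N}"
      unfolding subset_iff atMost_iff le_Suc_eq in_keys_iff by metis
    then show ?thesis
      using True by (simp add: pcoeff_X_mult_eq_0 pcoeff_trunc)
  next
    case False
    then obtain m' where m: "m = m' + Poly_Mapping.single (Suc N) 1"
      by (rule lookup_pos_decompose)
    have "\<not> Poly_Mapping.keys m \<subseteq> {..N}"
      using False by (auto simp: in_keys_iff subset_iff intro!: exI[of _ "Suc N"])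
    then have "pcoeff (trunc N (hsym (Suc n))) m = 0" by (simp add: pcoeff_trunc)
    moreover have "pcoeff (X (Suc N) * trunc (Suc N) (hsym n)) m = pcoeff (trunc (Suc N) (hsym n)) m'"
      unfolding m by (rule pcoeff_X_mult)
    moreover have "Poly_Mapping.keys m \<subseteq> {..Suc N} \<longleftrightarrow> Poly_Mapping.keys m' \<subseteq> {..Suc N}"
      by (simp add: m keys_add_nat)
    moreover have "Poly_Mapping.lookup m 0 = Poly_Mapping.lookup m' 0"
      by (simp add: m lookup_add lookup_single)
    ultimately show ?thesis
      using mon_degree_add_single[of m' "Suc N"] by (simp add: pcoeff_trunc pcoeff_hsym m del: One_nat_def)
  qed
qed

lemma trunc_Suc_hsym_sum:
  "trunc (Suc N) (hsym n) = (\<Sum>c\<le>n. X (Suc N) ^ (n - c) * trunc N (hsym c))"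
proof (induction n)
  case (Suc n)
  have "(\<Sum>c\<le>n. X (Suc N) ^ (Suc n - c) * trunc N (hsym c)) =
      X (Suc N) * (\<Sum>c\<le>n. X (Suc N) ^ (n - c) * trunc N (hsym c))"
    unfolding sum_distrib_left by (rule sum.cong) (auto simp: Suc_diff_le mult.assoc)
  then show ?case by (simp add: trunc_Suc_hsym Suc.IH add.commute)
qed (simp add: hsym_0)

text \<open>A shape interlacing with one row is a row of some length \<open>c \<le> n\<close>, and
  for \<open>\<beta> = 0\<close> free rows contribute no factor. For \<open>N = 0\<close> only the
  empty shape would interlace, so the recursion starts at one variable.\<close>

lemma tableau_sum_row_Suc:
  assumes "N > 0"
  shows "tableau_sum 0 (Suc N) (parts [n]) = (\<Sum>c\<le>n. X (Suc N) ^ (n - c) * tableau_sum 0 N (parts [c]))"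
proof -
  have anti: "antimono (parts [n])" by (auto simp: antimono_iff_le_Suc parts_def)
  have eq: "\<nu> = parts [\<nu> 0]" if "\<nu> \<in> interlacing N (parts [n])" for \<nu>
  proof
    fix i show "\<nu> i = parts [\<nu> 0] i"
      using that unfolding interlacing_def by (cases "i = 0"; cases "i < N") (auto simp: parts_def)
  qed
  have "tableau_sum 0 (Suc N) (parts [n]) = (\<Sum>\<nu>\<in>interlacing N (parts [n]).
      X (Suc N) ^ (\<Sum>i\<le>N. parts [n] i - \<nu> i) * tableau_sum 0 N \<nu>)"
    by (subst tableau_sum_branching[OF anti]) (auto simp: parts_def)
  also have "\<dots> = (\<Sum>c\<le>n. X (Suc N) ^ (n - c) * tableau_sum 0 N (parts [c]))"
  proof (rule sum.reindex_bij_witness[where i = "\<lambda>c. parts [c]" and j = "\<lambda>\<nu>. \<nu> 0"])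
    fix \<nu> assume \<nu>: "\<nu> \<in> interlacing N (parts [n])"
    show "parts [\<nu> 0] = \<nu>" using eq[OF \<nu>] ..
    show "\<nu> 0 \<in> {..n}" using \<nu> assms by (auto simp: interlacing_def parts_def)
    have "(\<Sum>i\<le>N. parts [n] i - \<nu> i) = (\<Sum>i\<in>{0}. parts [n] i - \<nu> i)"
      by (rule sum.mono_neutral_right) (auto simp: parts_def)
    then have "(\<Sum>i\<le>N. parts [n] i - \<nu> i) = n - \<nu> 0" by (simp add: parts_def)
    then show "X (Suc N) ^ (n - \<nu> 0) * tableau_sum 0 N (parts [\<nu> 0]) =
        X (Suc N) ^ (\<Sum>i\<le>N. parts [n] i - \<nu> i) * tableau_sum 0 N \<nu>"
      using eq[OF \<nu>] by simp
  next
    fix c assume "c \<in> {..n}"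
    then show "parts [c] \<in> interlacing N (parts [n])"
      using assms by (auto simp: interlacing_def parts_def)
  qed (simp add: parts_def)
  finally show ?thesis .
qed

lemma tableau_sum_row_1: "tableau_sum 0 (Suc 0) (parts [n]) = X (Suc 0) ^ n"
proof -
  have anti: "antimono (parts [n])" by (auto simp: antimono_iff_le_Suc parts_def)
  have "interlacing 0 (parts [n]) = {\<lambda>_. 0}" by (auto simp: interlacing_def)
  then show ?thesis
    by (subst tableau_sum_branching[OF anti]) (auto simp: parts_def tableau_sum_zero)
qed

text \<open>Both sides obey the same recursion in the number of variables and agree for one
  variable.\<close>

lemma schur_row: "schur [n] = hsym n"
proof (rule trunc_eqI)
  fix N :: nat assume "N \<ge> Suc 0"
  then show "trunc N (schur [n]) = trunc N (hsym n)"
  proof (induction N arbitrary: n rule: dec_induct)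
    case base
    have "(\<Sum>c\<le>n. X (Suc 0) ^ (n - c) * trunc 0 (hsym c)) = (\<Sum>c\<in>{0}. X (Suc 0) ^ (n - c) * trunc 0 (hsym c))"
      by (rule sum.mono_neutral_right) (auto simp: trunc_0_hsym)
    then show ?case
      by (simp add: trunc_schur tableau_sum_row_1 trunc_Suc_hsym_sum hsym_0)
  next
    case (step N)
    then show ?case
      by (simp add: trunc_schur tableau_sum_row_Suc trunc_Suc_hsym_sum)
  qed
qed

text \<open>The generating functions of elementary and complete symmetric functions are inverse to each
  other; this expresses \<open>hsym n\<close> by Schur functions of columns, whose products with Schur functions
  need no cancellation beyond equal columns.\<close>

definition esym_fps :: "nat \<Rightarrow> pseries fps" where
  "esym_fps N = (\<Prod>i<N. 1 - fps_const (X (Suc i)) * fps_X)"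

lemma esym_fps_nth: "fps_nth (esym_fps N) k = (- 1) ^ k * esym N k"
proof -
  have "esym_fps N = (\<Sum>S\<in>Pow {..<N}. \<Prod>i\<in>S. - (fps_const (X (Suc i)) * fps_X))"
    using prod_add[of "{..<N}" "\<lambda>i. - (fps_const (X (Suc i)) * fps_X)" "\<lambda>_. 1"]
    by (simp add: esym_fps_def)
  also have "\<dots> = (\<Sum>S\<in>Pow {..<N}. fps_const ((- 1) ^ card S * (\<Prod>i\<in>S. X (Suc i))) * fps_X ^ card S)"
  proof (rule sum.cong[OF refl])
    fix S assume "S \<in> Pow {..<N}"
    then have "finite S" by (auto intro: finite_subset)
    then show "(\<Prod>i\<in>S. - (fps_const (X (Suc i)) * fps_X)) =
        fps_const ((- 1) ^ card S * (\<Prod>i\<in>S. X (Suc i))) * fps_X ^ card S"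
      by (induction S rule: finite_induct)
        (simp_all add: mult_ac flip: fps_const_mult fps_const_neg)
  qed
  finally have "fps_nth (esym_fps N) k =
      (\<Sum>S\<in>Pow {..<N}. if card S = k then (- 1) ^ k * (\<Prod>i\<in>S. X (Suc i)) else 0)"
    by (auto simp: fps_sum_nth fps_X_power_nth intro!: sum.cong)
  also have "\<dots> = (- 1) ^ k * esym N k"
    by (simp add: sum.If_cases esym_def sum_distrib_left Pow_def Collect_conj_eq)
  finally show ?thesis .
qed

text \<open>By \<open>trunc_Suc_hsym\<close>, the factor belonging to the last variable reduces the
  generating function of the \<open>hsym n\<close> to one variable fewer.\<close>

lemma esym_fps_mult_hsym: "esym_fps N * Abs_fps (\<lambda>n. trunc N (hsym n)) = 1"
proof (induction N)
  case 0
  show ?case by (rule fps_ext) (simp add: esym_fps_def trunc_0_hsym)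
next
  case (Suc N)
  have "(1 - fps_const (X (Suc N)) * fps_X) * Abs_fps (\<lambda>n. trunc (Suc N) (hsym n)) =
      Abs_fps (\<lambda>n. trunc N (hsym n))"
  proof (rule fps_ext)
    fix n
    show "fps_nth ((1 - fps_const (X (Suc N)) * fps_X) * Abs_fps (\<lambda>n. trunc (Suc N) (hsym n))) n =
        fps_nth (Abs_fps (\<lambda>n. trunc N (hsym n))) n"
      by (cases n) (simp_all add: left_diff_distrib mult.assoc trunc_Suc_hsym hsym_0)
  qed
  then show ?case
    using Suc.IH by (simp add: esym_fps_def mult.assoc)
qed

lemma esym_hsym_sum:
  assumes "n > 0"
  shows "(\<Sum>i\<le>n. (- 1) ^ i * schur (replicate i 1) * hsym (n - i)) = 0"
proof (rule trunc_eqI)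
  fix N assume "N \<ge> n"
  have "trunc N ((- 1) ^ i * schur (replicate i 1) * hsym (n - i)) =
      fps_nth (esym_fps N) i * trunc N (hsym (n - i))" if "i \<le> n" for i
    using trunc_schur_column[of i N] that \<open>N \<ge> n\<close>
    by (simp add: esym_fps_nth del: replicate.simps)
  then have "trunc N (\<Sum>i\<le>n. (- 1) ^ i * schur (replicate i 1) * hsym (n - i)) =
      fps_nth (esym_fps N * Abs_fps (\<lambda>n. trunc N (hsym n))) n"
    by (simp add: fps_mult_nth atLeast0AtMost)
  also have "\<dots> = trunc N 0" using assms by (simp add: esym_fps_mult_hsym)
  finally show "trunc N (\<Sum>i\<le>n. (- 1) ^ i * schur (replicate i 1) * hsym (n - i)) = trunc N 0" .
qed

section \<open>Multiplication on the span of the Schur functions\<close>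

definition schur_span :: "pseries set" where
  "schur_span = span {schur l | l. is_partition l}"

lemma schur_in_span: "is_partition l \<Longrightarrow> schur l \<in> schur_span"
  unfolding schur_span_def by (rule span_base) blast

lemma column_mult_schur_span:
  assumes "f \<in> schur_span"
  shows "schur (replicate k 1) * f \<in> schur_span"
  using assms[unfolded schur_span_def]
proof (induction rule: span_induct_alt)
  case base
  show ?case by (simp add: schur_span_def span_zero)
next
  case (step c f g)
  then obtain l where l: "is_partition l" "f = schur l" by blast
  have "schur (part_list (add_strip (parts l) S)) \<in> schur_span"
    if "S \<in> strips (parts l) (length l + k)" for S
    using that by (intro schur_in_span is_partition_part_list[of _ "length l + k"])
      (auto simp: strips_def add_strip_def parts_def)
  then have "schur (replicate k 1) * f \<in> schur_span"
    unfolding l(2) column_mult_schur[OF l(1)] unfolding schur_span_def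
    by (intro span_sum) auto
  with step show ?case
    unfolding schur_span_def by (simp add: distrib_left span_add span_scale del: replicate.simps)
qed

text \<open>The multipliers of a subspace form an algebra automatically, so it suffices to check the
  generators of \<open>Lambda\<close>. Applying a multiplier to \<open>schur [] = 1\<close> then
  shows that it lies in the span.\<close>

definition span_multipliers :: "pseries set" where
  "span_multipliers = {f. \<forall>g\<in>schur_span. f * g \<in> schur_span}"

lemma is_subalgebra_span_multipliers: "is_subalgebra span_multipliers"
  unfolding is_subalgebra_def span_multipliers_def schur_span_def
  by (auto simp: distrib_right span_add span_scale mult.assoc)

text \<open>Solving \<open>esym_hsym_sum\<close> for \<open>hsym n\<close> leaves products of
  columns with \<open>hsym (n - i)\<close>, \<open>i \<ge> 1\<close>. These are multipliers by
  induction and by the Pieri rule.\<close>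

lemma hsym_span_multipliers: "hsym n \<in> span_multipliers"
proof (induction n rule: less_induct)
  case (less n)
  note alg = is_subalgebra_span_multipliers[unfolded is_subalgebra_def]
  show ?case
  proof (cases "n = 0")
    case True
    then show ?thesis using alg by (simp add: hsym_0)
  next
    case False
    have terms: "schur (replicate i 1) * hsym (n - i) \<in> span_multipliers" if "i \<in> {1..n}" for i
    proof -
      have "hsym (n - i) \<in> span_multipliers" using that by (intro less) auto
      then show ?thesis
        using column_mult_schur_span unfolding span_multipliers_def by (simp add: mult.assoc)
    qed
    \<comment> \<open>Signs are written as real scalars, because the multipliers are closed under
      scaling.\<close>
    have newton: "hsym n = (\<Sum>i\<in>{1..n}. (- ((- 1) ^ i)) *\<^sub>R (schur (replicate i 1) * hsym (n - i)))"
    proof -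
      have "(\<Sum>i\<le>n. (- 1) ^ i * schur (replicate i 1) * hsym (n - i)) =
          hsym n + (\<Sum>i\<in>{1..n}. (- 1) ^ i * schur (replicate i 1) * hsym (n - i))"
        by (subst sum.atMost_shift) (simp add: schur_Nil sum.atLeast1_atMost_eq del: replicate_Suc)
      then have "hsym n = - (\<Sum>i\<in>{1..n}. (- 1) ^ i * schur (replicate i 1) * hsym (n - i))"
        using esym_hsym_sum[of n] False by (simp add: eq_neg_iff_add_eq_0)
      also have "\<dots> = (\<Sum>i\<in>{1..n}. (- ((- 1) ^ i)) *\<^sub>R (schur (replicate i 1) * hsym (n - i)))"
        unfolding sum_negf[symmetric]
      proof (rule sum.cong[OF refl])
        fix i
        show "- ((- 1) ^ i * schur (replicate i 1) * hsym (n - i)) =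
          (- ((- 1) ^ i)) *\<^sub>R (schur (replicate i 1) * hsym (n - i))"
          by (cases "even i") simp_all
      qed
      finally show ?thesis .
    qed
    have sum: "(\<Sum>i\<in>A. c i *\<^sub>R f i) \<in> span_multipliers"
      if "\<And>i. i \<in> A \<Longrightarrow> f i \<in> span_multipliers" "finite A" for A :: "nat set" and c f
      using that(2,1)
    proof (induction A rule: finite_induct)
      case empty
      show ?case by (simp add: span_multipliers_def schur_span_def span_zero)
    qed (use alg in auto)
    show ?thesis
      by (subst newton, rule sum, rule terms) simp_all
  qed
qed

lemma Lambda_subset_schur_span: "Lambda \<subseteq> schur_span"
proof
  fix f assume "f \<in> Lambda"
  moreover have "Lambda \<subseteq> span_multipliers"
    unfolding Lambda_def
    by (rule hull_minimal) (use hsym_span_multipliers is_subalgebra_span_multipliers in auto)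
  ultimately have "f * schur [] \<in> schur_span"
    using schur_in_span[of "[]"] by (auto simp: span_multipliers_def)
  then show "f \<in> schur_span" by (simp add: schur_Nil)
qed

section \<open>Specializations are determined by the generators\<close>

lemma is_subalgebra_Lambda: "is_subalgebra Lambda"
  unfolding Lambda_def by (rule hull_in) (auto simp: is_subalgebra_def)

lemma hsym_in_Lambda: "n \<ge> 1 \<Longrightarrow> hsym n \<in> Lambda"
  unfolding Lambda_def by (rule hull_inc) blast

text \<open>The elements where both maps agree form a subalgebra containing the generators. They are
  taken inside \<open>Lambda\<close>, since the homomorphism laws hold only there.\<close>

lemma algebra_hom_on_Lambda_unique:
  assumes "algebra_hom_on Lambda \<rho>" "algebra_hom_on Lambda \<rho>'"
    and eq: "\<And>n. n \<ge> 1 \<Longrightarrow> \<rho>' (hsym n) = \<rho> (hsym n)" and f: "f \<in> Lambda"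
  shows "\<rho>' f = \<rho> f"
proof -
  have "Lambda \<subseteq> {f \<in> Lambda. \<rho>' f = \<rho> f}"
    unfolding Lambda_def
  proof (rule hull_minimal)
    show "{hsym n |n. 1 \<le> n} \<subseteq> {f \<in> is_subalgebra hull {hsym n |n. 1 \<le> n}. \<rho>' f = \<rho> f}"
      using eq hsym_in_Lambda[unfolded Lambda_def] by blast
    show "is_subalgebra {f \<in> is_subalgebra hull {hsym n |n. 1 \<le> n}. \<rho>' f = \<rho> f}"
      using assms(1,2) is_subalgebra_Lambda
      unfolding is_subalgebra_def algebra_hom_on_def Lambda_def[symmetric] by simp
  qed
  with f show ?thesis by blast
qed

section \<open>The specialization\<close>

lemma Gt_in_Gamma: "is_partition l \<Longrightarrow> Gt l \<in> Gamma"
  unfolding Gamma_def by (rule span_base) blast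

context
  fixes \<phi> :: "pseries \<Rightarrow> real"
  assumes hom: "algebra_hom_on Gamma \<phi>" and pos: "G_positive \<phi>"
begin

lemma phi_one: "\<phi> 1 = 1"
  and phi_add: "f \<in> Gamma \<Longrightarrow> g \<in> Gamma \<Longrightarrow> \<phi> (f + g) = \<phi> f + \<phi> g"
  and phi_mult: "f \<in> Gamma \<Longrightarrow> g \<in> Gamma \<Longrightarrow> \<phi> (f * g) = \<phi> f * \<phi> g"
  and phi_scaleR: "f \<in> Gamma \<Longrightarrow> \<phi> (c *\<^sub>R f) = c * \<phi> f"
  using hom by (auto simp: algebra_hom_on_def)

lemma Gamma_zero: "0 \<in> Gamma" and Gamma_one: "1 \<in> Gamma"
  and Gamma_add: "f \<in> Gamma \<Longrightarrow> g \<in> Gamma \<Longrightarrow> f + g \<in> Gamma"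
  and Gamma_scaleR: "f \<in> Gamma \<Longrightarrow> c *\<^sub>R f \<in> Gamma"
  using Gt_in_Gamma[of "[]"] by (auto simp: Gamma_def span_zero span_add span_scale Gt_Nil)

lemma phi_zero: "\<phi> 0 = 0"
  using phi_add[OF Gamma_zero Gamma_zero] by simp

text \<open>The expansion is a sum, without signs, of series \<open>Gt\<close> of partitions.
  Membership in \<open>Gamma\<close> is carried along because \<phi> is additive only there.\<close>

lemma Gt_expansion_nonneg:
  assumes "antimono \<mu>" "\<And>i. i \<ge> N \<Longrightarrow> \<mu> i = 0"
  shows "Gt_expansion p \<mu> \<in> Gamma \<and> 0 \<le> \<phi> (Gt_expansion p \<mu>)"
  using assms
proof (induction p arbitrary: \<mu> N)
  case 0
  have "is_partition (part_list \<mu>)" using 0 by (rule is_partition_part_list)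
  then show ?case using pos Gt_in_Gamma by (simp add: G_positive_def)
next
  case (Suc p)
  have IH: "Gt_expansion p (add_strip \<mu> S) \<in> Gamma \<and> 0 \<le> \<phi> (Gt_expansion p (add_strip \<mu> S))"
    if "S \<in> strips \<mu> (Suc p)" for S
  proof (rule Suc.IH)
    show "antimono (add_strip \<mu> S)" using that by (simp add: strips_def)
    show "add_strip \<mu> S i = 0" if "i \<ge> max N (Suc p)" for i
      using that \<open>S \<in> strips \<mu> (Suc p)\<close> Suc.prems(2)[of i] by (auto simp: strips_def add_strip_def)
  qed
  have "sum f A \<in> Gamma \<and> 0 \<le> \<phi> (sum f A)" if "finite A" "\<And>S. S \<in> A \<Longrightarrow> f S \<in> Gamma \<and> 0 \<le> \<phi> (f S)"
    for f :: "nat set \<Rightarrow> pseries" and A :: "nat set set"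
    using that by (induction A rule: finite_induct) (auto simp: Gamma_zero phi_zero Gamma_add phi_add)
  from this[OF finite_strips IH] show ?case by simp
qed

section \<open>Extending \<phi> by division by powers of \<open>P\<close>\<close>

definition P :: pseries where "P = 1 + Gt [1]"

lemma P_in_Gamma: "P \<in> Gamma"
  unfolding P_def by (intro Gamma_add Gamma_one Gt_in_Gamma) simp

lemma phi_P: "\<phi> P = 1 + \<phi> (Gt [1])"
  unfolding P_def by (subst phi_add) (auto simp: Gamma_one phi_one intro!: Gt_in_Gamma)

lemma phi_P_pos: "\<phi> P > 0"
  using pos by (auto simp: phi_P G_positive_def intro!: add_pos_nonneg)

text \<open>Requiring all exponents from \<open>K\<close> on makes the notion monotone in
  \<open>K\<close>, so that several series can share one exponent.\<close>

definition localizable :: "pseries \<Rightarrow> nat \<Rightarrow> bool" where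
  "localizable f K \<longleftrightarrow> (\<forall>k\<ge>K. P ^ k * f \<in> Gamma)"

text \<open>The least exponent is only a canonical choice: \<open>extension_eq\<close> shows that
  all admissible exponents give the same value.\<close>

definition extension :: "pseries \<Rightarrow> real" where
  "extension f = (let k = LEAST K. localizable f K in \<phi> (P ^ k * f) / \<phi> P ^ k)"

lemma localizable_mono: "localizable f K \<Longrightarrow> K \<le> L \<Longrightarrow> localizable f L"
  by (auto simp: localizable_def)

lemma phi_power_mult:
  assumes "localizable f K"
  shows "\<phi> (P ^ (n + K) * f) = \<phi> P ^ n * \<phi> (P ^ K * f)"
proof (induction n)
  case (Suc n)
  have "P ^ (n + K) * f \<in> Gamma" using assms by (simp add: localizable_def)
  from phi_mult[OF P_in_Gamma this] show ?case by (simp add: Suc.IH mult.assoc)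
qed simp

lemma extension_eq:
  assumes "localizable f K"
  shows "extension f = \<phi> (P ^ K * f) / \<phi> P ^ K"
proof -
  define L where "L = (LEAST K. localizable f K)"
  have "localizable f L" unfolding L_def using assms by (rule LeastI)
  moreover have "L \<le> K" unfolding L_def using assms by (rule Least_le)
  ultimately have "\<phi> (P ^ K * f) = \<phi> P ^ (K - L) * \<phi> (P ^ L * f)"
    using phi_power_mult[of f L "K - L"] by simp
  moreover have "\<phi> P ^ K = \<phi> P ^ (K - L) * \<phi> P ^ L"
    using \<open>L \<le> K\<close> by (simp add: power_add[symmetric])
  ultimately show ?thesis
    using phi_P_pos by (simp add: extension_def L_def[symmetric])
qed

lemma localizable_schur:
  assumes "is_partition l"
  shows "localizable (schur l) (length l)"
  unfolding localizable_def P_def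
proof (intro allI impI)
  fix k assume "length l \<le> k"
  then show "(1 + Gt [1]) ^ k * schur l \<in> Gamma"
    unfolding power_mult_schur[OF assms \<open>length l \<le> k\<close>]
    using Gt_expansion_nonneg[OF antimono_parts[OF assms] parts_eq_0] by blast
qed

lemma localizable_schur_span:
  assumes "f \<in> schur_span"
  shows "\<exists>K. localizable f K"
  using assms[unfolded schur_span_def]
proof (induction rule: span_induct_alt)
  case base
  show ?case by (simp add: localizable_def Gamma_zero)
next
  case (step c f g)
  then obtain l K where l: "is_partition l" "f = schur l" and K: "localizable g K" by blast
  have "localizable f (max (length l) K)"
    unfolding l(2) by (rule localizable_mono[OF localizable_schur[OF l(1)]]) simp
  moreover have "localizable g (max (length l) K)"
    by (rule localizable_mono[OF K]) simp
  ultimately have "localizable (c *\<^sub>R f + g) (max (length l) K)"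
    by (auto simp: localizable_def distrib_left intro!: Gamma_add Gamma_scaleR)
  then show ?case by blast
qed

lemma common_localizable:
  assumes "f \<in> Lambda" "g \<in> Lambda"
  obtains K where "localizable f K" "localizable g K"
proof -
  obtain K L where "localizable f K" "localizable g L"
    using localizable_schur_span Lambda_subset_schur_span assms by (meson subsetD)
  then show ?thesis using that[of "max K L"] localizable_mono by (meson max.cobounded1 max.cobounded2)
qed

lemma specialization_extension: "specialization extension"
  unfolding algebra_hom_on_def
proof (intro conjI ballI allI)
  have "localizable 1 0" using localizable_schur[of "[]"] by (simp add: schur_Nil)
  then show "extension 1 = 1" by (simp add: extension_eq phi_one)
next
  fix f g assume fg: "f \<in> Lambda" "g \<in> Lambda"
  then obtain K where K: "localizable f K" "localizable g K" by (rule common_localizable)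
  then have in_Gamma: "P ^ K * f \<in> Gamma" "P ^ K * g \<in> Gamma" by (auto simp: localizable_def)
  have "localizable (f + g) K" using K by (auto simp: localizable_def distrib_left intro!: Gamma_add)
  then show "extension (f + g) = extension f + extension g"
    using K by (simp add: extension_eq distrib_left phi_add[OF in_Gamma] add_divide_distrib)
  \<comment> \<open>The product has its own exponent \<open>L\<close>, obtained from its Schur
    expansion.\<close>
  have "f * g \<in> Lambda" using fg is_subalgebra_Lambda by (auto simp: is_subalgebra_def)
  then obtain L where L: "localizable (f * g) L"
    using localizable_schur_span Lambda_subset_schur_span by blast
  \<comment> \<open>With \<open>K + L\<close> used for each factor, the doubled exponent is at least
    \<open>L\<close> and splits evenly over the product.\<close>
  have K': "localizable f (K + L)" and L': "localizable (f * g) ((K + L) + (K + L))"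
    and K'': "localizable g (K + L)"
    using K L by (auto elim: localizable_mono)
  have "P ^ ((K + L) + (K + L)) * (f * g) = (P ^ (K + L) * f) * (P ^ (K + L) * g)"
    by (simp add: power_add mult_ac)
  then have "\<phi> (P ^ ((K + L) + (K + L)) * (f * g)) = \<phi> (P ^ (K + L) * f) * \<phi> (P ^ (K + L) * g)"
    using phi_mult K' K'' by (simp only: localizable_def order_refl)
  then show "extension (f * g) = extension f * extension g"
    by (simp add: extension_eq[OF L'] extension_eq[OF K'] extension_eq[OF K''] power_add)
next
  fix c f assume "f \<in> Lambda"
  then obtain K where K: "localizable f K" using common_localizable by blast
  then have "localizable (c *\<^sub>R f) K" by (auto simp: localizable_def intro: Gamma_scaleR)
  moreover have "P ^ K * f \<in> Gamma" using K by (simp add: localizable_def)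
  ultimately show "extension (c *\<^sub>R f) = c * extension f"
    using K by (simp add: extension_eq phi_scaleR)
qed

text \<open>For one row the exponent 1 suffices, and the expansion reads
  \<open>P * hsym n = Gt [n] + Gt [n + 1]\<close>.\<close>

lemma extension_hsym:
  assumes "n \<ge> 1"
  shows "extension (hsym n) = (\<phi> (Gt [n]) + \<phi> (Gt [n + 1])) / (1 + \<phi> (Gt [1]))"
proof -
  have part: "is_partition [n]" using assms by simp
  have "P ^ 1 * schur [n] = Gt [n] + Gt [Suc n]"
    unfolding P_def using power_mult_schur[OF part, of 1] Gt_expansion_single[of n] part_list_parts[OF part]
    by simp
  then have "\<phi> (P ^ 1 * schur [n]) = \<phi> (Gt [n]) + \<phi> (Gt [n + 1])"
    using part by (simp add: phi_add Gt_in_Gamma)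
  then show ?thesis
    using extension_eq[OF localizable_schur[OF part]] by (simp add: schur_row phi_P)
qed

text \<open>With exponent \<open>length l\<close> the numerator is the value of \<phi> on a sum of
  series \<open>Gt\<close> without signs, and the denominator is a power of the positive number
  \<open>\<phi> P\<close>.\<close>

lemma schur_positive_extension: "schur_positive extension"
  unfolding schur_positive_def
proof (intro allI impI)
  fix l assume l: "is_partition l"
  have "0 \<le> \<phi> (P ^ length l * schur l)"
    unfolding P_def power_mult_schur[OF l order_refl]
    using Gt_expansion_nonneg[OF antimono_parts[OF l] parts_eq_0] by blast
  then show "0 \<le> extension (schur l)"
    using phi_P_pos by (simp add: extension_eq[OF localizable_schur[OF l]])
qed

end

theorem theorem1p4:
  fixes \<phi> :: "pseries \<Rightarrow> real"
  assumes "algebra_hom_on Gamma \<phi>"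
    and "G_positive \<phi>"
  shows "\<exists>\<rho>. specialization \<rho> \<and>
      (\<forall>n\<ge>1. \<rho> (hsym n) = (\<phi> (Gt [n]) + \<phi> (Gt [n + 1])) / (1 + \<phi> (Gt [1]))) \<and>
      schur_positive \<rho> \<and>
      (\<forall>\<rho>'. specialization \<rho>' \<and>
        (\<forall>n\<ge>1. \<rho>' (hsym n) = (\<phi> (Gt [n]) + \<phi> (Gt [n + 1])) / (1 + \<phi> (Gt [1])))
        \<longrightarrow> (\<forall>f\<in>Lambda. \<rho>' f = \<rho> f))"
proof (intro exI[of _ "extension \<phi>"] conjI allI impI ballI)
  fix \<rho>' f
  assume \<rho>': "specialization \<rho>' \<and>
      (\<forall>n\<ge>1. \<rho>' (hsym n) = (\<phi> (Gt [n]) + \<phi> (Gt [n + 1])) / (1 + \<phi> (Gt [1])))"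
    and "f \<in> Lambda"
  show "\<rho>' f = extension \<phi> f"
  proof (rule algebra_hom_on_Lambda_unique[OF specialization_extension[OF assms]])
    show "specialization \<rho>'" using \<rho>' ..
    show "\<rho>' (hsym n) = extension \<phi> (hsym n)" if "n \<ge> 1" for n
      using \<rho>' that extension_hsym[OF assms that] by simp
  qed fact
qed (use specialization_extension[OF assms] extension_hsym[OF assms] schur_positive_extension[OF assms] in auto)

end
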